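(* Let $\mathfrak S$ be a finite subset of $\mathbb Z^2$ with small height variations, i.e. $|j|\le1$ for all $(i,j)\in\mathfrak S$. For $j\in\{-1,0,1\}$ let $A_j(x)=\sum_{(i,j)\in\mathfrak S}x^i$, so that $K(x,y;t)=1-t\bar yA_{-1}(x)-tA_0(x)-tyA_1(x)$, and let $$\Delta(x;t)=(1-tA_0(x))^2-4t^2A_1(x)A_{-1}(x).$$ Then the generating function of bilateral walks with steps in $\mathfrak S$ is $B(x;t)=1/\sqrt{\Delta(x;t)}$. Let $(\Delta_0(t),\Delta_+(x;t),\Delta_-(\bar x;t))$ be the canonical factorization of $\Delta(x;t)$. Then the generating functions of walks on the slit plane, of bilateral walks on the slit plane, and of loops (all with steps in $\mathfrak S$) are $$S(x,y;t)=\frac{\sqrt{\Delta_0(t)\Delta_-(\bar x;t)}}{K(x,y;t)},\qquad S_0(x;t)=\frac1{\sqrt{\Delta_+(x;t)}},\qquad L(t)=\frac1{\sqrt{\Delta_0(t)}},$$ and all these series are algebraic.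
   Context: $\bar x=1/x$, $\bar y=1/y$. A walk with steps in $\mathfrak S$ is a sequence $(w_0,\dots,w_n)$ of points of $\mathbb Z^2$ with $w_0=(0,0)$ and $w_k-w_{k-1}\in\mathfrak S$; $n$ is its length. It is on the slit plane if none of $w_1,\dots,w_n$ lies on $\mathcal H=\{(k,0):k\le0\}$; bilateral if $w_n$ lies on the $x$-axis; a loop if $w_n=(0,0)$ and no $w_k$ lies on $\{(k,0):k<0\}$. The generating function of a set of walks is $\sum_nt^n\sum_{i,j}a_{i,j}(n)x^iy^j$ with $a_{i,j}(n)$ the number of its walks of length $n$ ending at $(i,j)$ ($y$ omitted for walks ending on the $x$-axis, only $t$ for loops). Canonical factorization: for a power series $D(x;t)$ in $t$ with coefficients in $\mathbb R[x,\bar x]$ and $D(x;0)=1$, there is a unique triple of formal power series in $t$ with $D=D_0(t)D_+(x;t)D_-(\bar x;t)$, where $D_0$ has real coefficients, $D_+$ has coefficients in $\mathbb R[x]$, $D_-$ has coefficients in $\mathbb R[\bar x]$, and $D_0(0)=D_+(x;0)=D_-(\bar x;0)=D_+(0;t)=D_-(0;t)=1$. *)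

theory Defs
  imports
    "HOL-Library.Poly_Mapping"
    "HOL-Library.Product_Plus"
    "HOL-Computational_Algebra.Polynomial_FPS"
begin

text \<open>
  Laurent polynomials in \<open>x\<close> and \<open>y\<close> over the reals are the group ring of \<open>\<int> \<times> \<int>\<close>: the key
  \<open>(i, j)\<close> stands for the monomial \<open>x^i y^j\<close>. A series in \<open>t\<close> is a formal power series over this
  ring. Series that involve only some of the variables live in the same ring, with the
  exponents restricted accordingly.
\<close>

type_synonym laurent = "(int \<times> int) \<Rightarrow>\<^sub>0 real"

definition mon :: "int \<Rightarrow> int \<Rightarrow> laurent" where
  "mon i j = Poly_Mapping.single (i, j) 1"

definition const_ring :: "laurent set"  \<comment> \<open>the reals\<close>
  where "const_ring = {p. Poly_Mapping.keys p \<subseteq> {0} \<times> {0}}"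

definition poly_x :: "laurent set"  \<comment> \<open>\<open>\<real>[x]\<close>\<close>
  where "poly_x = {p. Poly_Mapping.keys p \<subseteq> {0..} \<times> {0}}"

definition poly_xbar :: "laurent set"  \<comment> \<open>\<open>\<real>[1/x]\<close>\<close>
  where "poly_xbar = {p. Poly_Mapping.keys p \<subseteq> {..0} \<times> {0}}"

definition poly_xy :: "laurent set"  \<comment> \<open>\<open>\<real>[x, y]\<close>\<close>
  where "poly_xy = {p. Poly_Mapping.keys p \<subseteq> {0..} \<times> {0..}}"


text \<open>
  Reciprocals and square roots of series with constant term \<open>1\<close> in \<open>t\<close>. The class-based
  \<open>inverse\<close> on \<open>fps\<close> is not available, as Laurent polynomials do not form a field.
\<close>

definition recip :: "laurent fps \<Rightarrow> laurent fps" where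
  "recip F = fps_right_inverse F 1"

lemma recip: "fps_nth F 0 = 1 \<Longrightarrow> F * recip F = 1"
  unfolding recip_def by (rule fps_right_inverse) simp

definition sqrt_fps :: "laurent fps \<Rightarrow> laurent fps" where
  "sqrt_fps F = (THE G. G ^ 2 = F \<and> fps_nth G 0 = 1)"


text \<open>
  A series is algebraic if it is a root of a nonzero polynomial whose coefficients are
  polynomials in \<open>t\<close> over \<open>R\<close>; here \<open>R\<close> is the ring of real polynomials in the variables other
  than \<open>t\<close> of which the series is a function.
\<close>

definition algebraic_series :: "laurent set \<Rightarrow> laurent fps \<Rightarrow> bool" where
  "algebraic_series R F \<longleftrightarrow>
     (\<exists>P :: laurent poly poly. P \<noteq> 0 \<and> (\<forall>i j. coeff (coeff P i) j \<in> R) \<and>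
        poly (map_poly fps_of_poly P) F = 0)"


text \<open>
  In the last two conditions, setting \<open>x = 0\<close> in an element of \<open>\<real>[x]\<close>, or \<open>1/x = 0\<close> in an element
  of \<open>\<real>[1/x]\<close>, extracts the coefficient of \<open>x^0 y^0\<close>.
\<close>

definition is_canonical_factorization ::
  "laurent fps \<Rightarrow> laurent fps \<Rightarrow> laurent fps \<Rightarrow> laurent fps \<Rightarrow> bool" where
  "is_canonical_factorization D D0 Dp Dm \<longleftrightarrow>
     D = D0 * Dp * Dm \<and>
     (\<forall>n. fps_nth D0 n \<in> const_ring) \<and>
     (\<forall>n. fps_nth Dp n \<in> poly_x) \<and>
     (\<forall>n. fps_nth Dm n \<in> poly_xbar) \<and>
     fps_nth D0 0 = 1 \<and> fps_nth Dp 0 = 1 \<and> fps_nth Dm 0 = 1 \<and>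
     (\<forall>n. Poly_Mapping.lookup (fps_nth Dp n) (0, 0) = (if n = 0 then 1 else 0)) \<and>
     (\<forall>n. Poly_Mapping.lookup (fps_nth Dm n) (0, 0) = (if n = 0 then 1 else 0))"

definition canonical_factorization ::
  "laurent fps \<Rightarrow> laurent fps \<times> laurent fps \<times> laurent fps" where
  "canonical_factorization D =
     (THE T. case T of (D0, Dp, Dm) \<Rightarrow> is_canonical_factorization D D0 Dp Dm)"


text \<open>A walk of length \<open>n\<close> is the list of its \<open>n + 1\<close> points.\<close>

definition walks :: "(int \<times> int) set \<Rightarrow> (int \<times> int) list set" where
  "walks S = {w. w \<noteq> [] \<and> w ! 0 = (0, 0) \<and>
                 (\<forall>k. 1 \<le> k \<and> k < length w \<longrightarrow> w ! k - w ! (k - 1) \<in> S)}"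

definition on_slit_plane :: "(int \<times> int) list \<Rightarrow> bool" where
  "on_slit_plane w \<longleftrightarrow> (\<forall>k. 1 \<le> k \<and> k < length w \<longrightarrow> w ! k \<notin> {(i, 0) | i. i \<le> 0})"

definition bilateral :: "(int \<times> int) list \<Rightarrow> bool" where
  "bilateral w \<longleftrightarrow> snd (last w) = 0"

definition is_loop :: "(int \<times> int) list \<Rightarrow> bool" where
  "is_loop w \<longleftrightarrow> last w = (0, 0) \<and> (\<forall>k < length w. w ! k \<notin> {(i, 0) | i. i < 0})"

definition num_walks :: "(int \<times> int) list set \<Rightarrow> nat \<Rightarrow> int \<times> int \<Rightarrow> nat" where
  "num_walks W n p = card {w \<in> W. length w = n + 1 \<and> last w = p}"

text \<open>
  The sum runs over the endpoints of walks of length \<open>n\<close>; this set is finite whenever the step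
  set is.
\<close>

definition walk_gf :: "(int \<times> int) list set \<Rightarrow> laurent fps" where
  "walk_gf W = Abs_fps (\<lambda>n. \<Sum>(i, j) \<in> last ` {w \<in> W. length w = n + 1}.
                  of_nat (num_walks W n (i, j)) * mon i j)"


definition step_poly :: "(int \<times> int) set \<Rightarrow> int \<Rightarrow> laurent"  \<comment> \<open>\<open>A\<^sub>j(x)\<close>\<close>
  where "step_poly S j = (\<Sum>i \<in> {i. (i, j) \<in> S}. mon i 0)"

definition walk_kernel :: "(int \<times> int) set \<Rightarrow> laurent fps" where
  "walk_kernel S = 1 - fps_X * fps_const (mon 0 (-1) * step_poly S (-1))
                - fps_X * fps_const (step_poly S 0)
                - fps_X * fps_const (mon 0 1 * step_poly S 1)"

definition Delta :: "(int \<times> int) set \<Rightarrow> laurent fps" where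
  "Delta S = (1 - fps_X * fps_const (step_poly S 0)) ^ 2
             - 4 * fps_X ^ 2 * fps_const (step_poly S 1) * fps_const (step_poly S (-1))"

end

theory Submission
  imports Defs "HOL-Algebra.Algebraic_Closure_Type" "HOL-Library.Product_Lexorder"
begin

text \<open>
  Cutting a walk at its first visit to a set of points gives \<open>S K = 1 - H\<close>, where \<open>H\<close> counts the walks
  that end at their first visit to the slit. Extracting \<open>y^0\<close> yields \<open>S_0(x) = (1 - H(1/x)) B(x)\<close>, and
  \<open>B^2 \<Delta> = 1\<close> follows from a factorization of the kernel in \<open>y\<close>. Hence
  \<open>\<Delta> = (1 - H)^2 / S_0^2\<close>, which is the canonical factorization up to the term of \<open>1 - H\<close> that is
  constant in \<open>x\<close>; that term is \<open>1 / L\<close>.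

  For algebraicity, the canonical factors turn out to be polynomials in \<open>x\<close> and \<open>1/x\<close>. Their
  coefficients are algebraic over \<open>\<real>[t]\<close>, being up to a factor in \<open>\<real>[t]\<close> symmetric functions of roots of
  \<open>x^m \<Delta>\<close> in an algebraic closure.
\<close>

section \<open>Elements algebraic over a subring\<close>

text \<open>The existence of the canonical factorization is not proved separately: the walk series
  themselves exhibit a factorization of \<open>Delta S\<close>, and uniqueness does the rest. They
  fit because a walk ending at its first visit to the slit contributes only \<open>x^i\<close> with
  \<open>i \<le> 0\<close>, while a bilateral walk on the slit plane is trivial or ends at some
  \<open>i > 0\<close>.

  All series live in the single ring \<open>laurent fps\<close>, a domain but not a field. Subrings
  are therefore cut out by sets of exponents, and algebraic elements are treated relative to a
  subring with denominators cleared by hand. Algebraicity is claimed over polynomials in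
  \<open>x\<close> and \<open>y\<close>, although \<open>Delta S\<close> and the kernel may contain
  negative powers; this is repaired by the fact that \<open>1/x\<close> and \<open>1/y\<close> are
  algebraic over such polynomials.\<close>

locale subring_of =
  fixes A :: "'a::comm_ring_1 set"
  assumes one_closed: "1 \<in> A"
    and add_closed: "a \<in> A \<Longrightarrow> b \<in> A \<Longrightarrow> a + b \<in> A"
    and mult_closed: "a \<in> A \<Longrightarrow> b \<in> A \<Longrightarrow> a * b \<in> A"
    and uminus_closed: "a \<in> A \<Longrightarrow> - a \<in> A"
begin

lemma zero_closed: "0 \<in> A"
  using add_closed[OF one_closed uminus_closed[OF one_closed]] by simp

lemma diff_closed: "a \<in> A \<Longrightarrow> b \<in> A \<Longrightarrow> a - b \<in> A"
  using add_closed[of a "- b"] uminus_closed[of b] by simp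

lemma sum_closed: "(\<And>i. i \<in> I \<Longrightarrow> f i \<in> A) \<Longrightarrow> sum f I \<in> A"
  by (induction I rule: infinite_finite_induct) (auto intro: zero_closed add_closed)

lemma power_closed: "a \<in> A \<Longrightarrow> a ^ n \<in> A"
  by (induction n) (auto intro: one_closed mult_closed)

lemma coeff_mult_closed:
  assumes "\<And>i. Polynomial.coeff p i \<in> A" "\<And>i. Polynomial.coeff q i \<in> A"
  shows "Polynomial.coeff (p * q) i \<in> A"
  unfolding Polynomial.coeff_mult by (intro sum_closed mult_closed assms)

lemma coeff_prod_linear_closed:
  assumes "\<And>x. x \<in># M \<Longrightarrow> x \<in> A"
  shows "Polynomial.coeff (\<Prod>x\<in>#M. [:-x, 1:]) i \<in> A"
  using assms
proof (induction M arbitrary: i)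
  case empty
  show ?case by (simp add: zero_closed one_closed)
next
  case (add x M)
  have "Polynomial.coeff [:-x, 1:] i \<in> A" for i
    using add.prems by (auto simp: coeff_pCons zero_closed one_closed uminus_closed split: nat.split)
  with add show ?case by (simp add: coeff_mult_closed del: mult_pCons_left)
qed

end

definition algebraic_over :: "'a::idom set \<Rightarrow> 'a \<Rightarrow> bool" where
  "algebraic_over A b \<longleftrightarrow>
     (\<exists>p. p \<noteq> 0 \<and> (\<forall>i. Polynomial.coeff p i \<in> A) \<and> poly p b = 0)"

section \<open>Finitely generated spans and the ring of algebraic elements\<close>

definition span_over :: "'a::comm_ring_1 set \<Rightarrow> 'a set \<Rightarrow> 'a set" where
  "span_over A G = {\<Sum>g\<in>G. c g * g | c. \<forall>g\<in>G. c g \<in> A}"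

text \<open>Fraction-free Gaussian elimination keeps the solution inside the subring.\<close>

lemma (in subring_of) homogeneous_system_nontrivial_solution:
  fixes M :: "'i \<Rightarrow> 'j \<Rightarrow> 'a"
  assumes idom: "\<And>a b. a \<in> A \<Longrightarrow> b \<in> A \<Longrightarrow> a * b = 0 \<Longrightarrow> a = 0 \<or> b = 0"
    and "finite I" "finite J" "card I < card J"
    and "\<And>i j. i \<in> I \<Longrightarrow> j \<in> J \<Longrightarrow> M i j \<in> A"
  shows "\<exists>c. (\<forall>j\<in>J. c j \<in> A) \<and> (\<exists>j\<in>J. c j \<noteq> 0) \<and> (\<forall>i\<in>I. (\<Sum>j\<in>J. M i j * c j) = 0)"
  using assms(2-)
proof (induction I arbitrary: J M rule: finite_induct)
  case empty
  then have "J \<noteq> {}" by auto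
  then show ?case by (intro exI[of _ "\<lambda>_. 1"]) (auto simp: one_closed)
next
  case (insert r I)
  show ?case
  proof (cases "\<forall>j\<in>J. M r j = 0")
    case True
    have "\<exists>c. (\<forall>j\<in>J. c j \<in> A) \<and> (\<exists>j\<in>J. c j \<noteq> 0) \<and> (\<forall>i\<in>I. (\<Sum>j\<in>J. M i j * c j) = 0)"
      using insert by (intro insert.IH) auto
    then obtain c where "\<forall>j\<in>J. c j \<in> A" "\<exists>j\<in>J. c j \<noteq> 0" "\<forall>i\<in>I. (\<Sum>j\<in>J. M i j * c j) = 0"
      by blast
    with True show ?thesis by (intro exI[of _ c]) simp
  next
    case False
    then obtain j0 where j0: "j0 \<in> J" "M r j0 \<noteq> 0" by auto
    define J' where "J' = J - {j0}"
    define \<pi> where "\<pi> = M r j0"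
    have J': "J = insert j0 J'" "j0 \<notin> J'" "finite J'"
      using j0 insert.prems by (auto simp: J'_def)
    have MA: "M i j \<in> A" if "i \<in> insert r I" "j \<in> insert j0 J'" for i j
      using that insert.prems(3) J' by auto
    have \<pi>: "\<pi> \<in> A" "\<pi> \<noteq> 0" using j0 MA by (auto simp: \<pi>_def)
    \<comment> \<open>The pivot row \<open>r\<close> is used to eliminate the unknown
      \<open>j0\<close> from the other rows, each of which is first multiplied by the pivot.\<close>
    have "\<exists>c. (\<forall>j\<in>J'. c j \<in> A) \<and> (\<exists>j\<in>J'. c j \<noteq> 0) \<and>
      (\<forall>i\<in>I. (\<Sum>j\<in>J'. (\<pi> * M i j - M r j * M i j0) * c j) = 0)"
      using insert.prems insert.hyps J'
      by (intro insert.IH diff_closed mult_closed \<pi> MA) auto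
    then obtain c where c: "\<And>j. j \<in> J' \<Longrightarrow> c j \<in> A" "\<exists>j\<in>J'. c j \<noteq> 0"
      "\<And>i. i \<in> I \<Longrightarrow> (\<Sum>j\<in>J'. (\<pi> * M i j - M r j * M i j0) * c j) = 0"
      by metis
    \<comment> \<open>Back-substitution: row \<open>r\<close> would require dividing by
      \<open>\<pi>\<close> to recover the unknown \<open>j0\<close>, so all other unknowns are
      multiplied by \<open>\<pi>\<close> instead.\<close>
    define d where "d j = (if j = j0 then - (\<Sum>j\<in>J'. M r j * c j) else \<pi> * c j)" for j
    have d_sum: "(\<Sum>j\<in>J. M i j * d j) = (\<Sum>j\<in>J'. (\<pi> * M i j - M r j * M i j0) * c j)" for i
    proof -
      have "(\<Sum>j\<in>J. M i j * d j) = M i j0 * d j0 + (\<Sum>j\<in>J'. M i j * (\<pi> * c j))"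
        using J' by (auto simp: d_def intro!: sum.cong)
      also have "\<dots> = (\<Sum>j\<in>J'. (\<pi> * M i j - M r j * M i j0) * c j)"
        by (simp add: d_def sum_distrib_left sum_subtractf[symmetric] algebra_simps)
      finally show ?thesis .
    qed
    show ?thesis
    proof (intro exI[of _ d] conjI ballI)
      show "d j \<in> A" if "j \<in> J" for j
        using that c(1) MA J' \<pi> by (auto simp: d_def intro!: uminus_closed sum_closed mult_closed)
      from c(2) obtain j where "j \<in> J'" "c j \<noteq> 0" by auto
      then have "j \<in> J" "d j \<noteq> 0"
        using J' c(1)[of j] idom[of \<pi> "c j"] \<pi> by (auto simp: d_def)
      then show "\<exists>j\<in>J. d j \<noteq> 0" by auto
      show "(\<Sum>j\<in>J. M i j * d j) = 0" if "i \<in> insert r I" for i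
        using that c(3) unfolding d_sum by (auto simp: \<pi>_def mult.commute)
    qed
  qed
qed

locale subdomain_of = subring_of A for A :: "'a::idom set"
begin

lemma span_base: "finite G \<Longrightarrow> g \<in> G \<Longrightarrow> g \<in> span_over A G"
  unfolding span_over_def
  by (auto intro!: exI[of _ "\<lambda>h. if h = g then 1 else 0"] simp: if_distrib[of "\<lambda>x. x * _"] sum.delta one_closed zero_closed cong: if_cong)

lemma span_add: "x \<in> span_over A G \<Longrightarrow> y \<in> span_over A G \<Longrightarrow> x + y \<in> span_over A G"
  unfolding span_over_def
  apply clarify
  subgoal for c d
    by (rule exI[of _ "\<lambda>g. c g + d g"]) (auto simp: sum.distrib algebra_simps intro: add_closed)
  done

lemma span_scale: "a \<in> A \<Longrightarrow> x \<in> span_over A G \<Longrightarrow> a * x \<in> span_over A G"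
  unfolding span_over_def
  apply clarify
  subgoal for c
    by (rule exI[of _ "\<lambda>g. a * c g"]) (auto simp: sum_distrib_left mult.assoc intro: mult_closed)
  done

lemma span_zero: "0 \<in> span_over A G"
  unfolding span_over_def by (auto intro!: exI[of _ "\<lambda>_. 0"] zero_closed)

lemma span_sum: "(\<And>i. i \<in> I \<Longrightarrow> f i \<in> span_over A G) \<Longrightarrow> sum f I \<in> span_over A G"
  by (induction I rule: infinite_finite_induct) (auto intro: span_zero span_add)

lemma span_mult_subset:
  assumes "x \<in> span_over A G" "\<And>g. g \<in> G \<Longrightarrow> b * g \<in> span_over A H"
  shows "b * x \<in> span_over A H"
proof -
  from assms(1) obtain c where c: "\<And>g. g \<in> G \<Longrightarrow> c g \<in> A" "x = (\<Sum>g\<in>G. c g * g)"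
    by (auto simp: span_over_def)
  have "b * x = (\<Sum>g\<in>G. c g * (b * g))"
    by (simp add: c(2) sum_distrib_left algebra_simps)
  also have "\<dots> \<in> span_over A H"
    by (intro span_sum span_scale c(1) assms(2))
  finally show ?thesis .
qed

text \<open>Over the fraction field of \<open>A\<close>, being algebraic means that multiplication
  by \<open>b\<close> preserves a finite-dimensional space containing 1. The factor
  \<open>\<delta>\<close> is a common denominator that keeps the statement inside the ring. Spans
  combine easily under sums, products and square roots, where annihilating polynomials do
  not.\<close>

lemma algebraic_over_iff_span:
  "algebraic_over A b \<longleftrightarrow>
     (\<exists>G \<delta>. finite G \<and> 1 \<in> G \<and> \<delta> \<in> A \<and> \<delta> \<noteq> 0 \<and> (\<forall>g\<in>G. \<delta> * b * g \<in> span_over A G))"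
proof
  assume "algebraic_over A b"
  then obtain p where p: "p \<noteq> 0" "\<And>i. Polynomial.coeff p i \<in> A" "poly p b = 0"
    by (auto simp: algebraic_over_def)
  define n where "n = Polynomial.degree p"
  define \<delta> where "\<delta> = Polynomial.lead_coeff p"
  define G where "G = (\<lambda>i. b ^ i) ` {..<n}"
  have "n \<noteq> 0"
  proof
    assume "n = 0"
    then obtain c where "p = [:c:]" by (metis n_def degree_eq_zeroE)
    with p show False by simp
  qed
  have G: "finite G" "1 \<in> G"
    using \<open>n \<noteq> 0\<close> by (auto simp: G_def image_iff intro!: bexI[of _ 0])
  have base: "b ^ i \<in> span_over A G" if "i < n" for i
    using that G by (intro span_base) (auto simp: G_def)
  have top: "\<delta> * b ^ n \<in> span_over A G"
  proof -
    have "poly p b = (\<Sum>i\<le>n. Polynomial.coeff p i * b ^ i)"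
      by (simp add: poly_altdef n_def)
    also have "{..n} = insert n {..<n}" by auto
    finally have "\<delta> * b ^ n = (\<Sum>i<n. (- Polynomial.coeff p i) * b ^ i)"
      using p(3) by (simp add: \<delta>_def n_def sum_negf eq_neg_iff_add_eq_0)
    also have "\<dots> \<in> span_over A G" using base by (intro span_sum span_scale uminus_closed p(2)) auto
    finally show ?thesis .
  qed
  have "\<delta> * b * g \<in> span_over A G" if "g \<in> G" for g
  proof -
    from that obtain i where i: "i < n" "g = b ^ i" by (auto simp: G_def)
    have "\<delta> * b ^ Suc i \<in> span_over A G"
    proof (cases "Suc i < n")
      case True
      then show ?thesis by (intro span_scale base) (auto simp: \<delta>_def p)
    next
      case False
      with i have "n = Suc i" by simp
      with top show ?thesis by simp
    qed
    with i show ?thesis by (simp add: mult.assoc)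
  qed
  then show "\<exists>G \<delta>. finite G \<and> 1 \<in> G \<and> \<delta> \<in> A \<and> \<delta> \<noteq> 0 \<and> (\<forall>g\<in>G. \<delta> * b * g \<in> span_over A G)"
    using G p by (intro exI[of _ G] exI[of _ \<delta>]) (auto simp: \<delta>_def)
next
  assume "\<exists>G \<delta>. finite G \<and> 1 \<in> G \<and> \<delta> \<in> A \<and> \<delta> \<noteq> 0 \<and> (\<forall>g\<in>G. \<delta> * b * g \<in> span_over A G)"
  then obtain G \<delta> where G: "finite G" "1 \<in> G" "\<delta> \<in> A" "\<delta> \<noteq> 0"
    "\<And>g. g \<in> G \<Longrightarrow> \<delta> * b * g \<in> span_over A G" by blast
  have "(\<delta> * b) ^ N \<in> span_over A G" for N
  proof (induction N)
    case 0
    show ?case using G by (auto intro: span_base)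
  next
    case (Suc N)
    show ?case using span_mult_subset[OF Suc G(5)] by simp
  qed
  then have "\<forall>N. \<exists>c. (\<forall>g\<in>G. c g \<in> A) \<and> (\<delta> * b) ^ N = (\<Sum>g\<in>G. c g * g)"
    by (auto simp: span_over_def)
  then obtain c where c: "\<And>N g. g \<in> G \<Longrightarrow> c N g \<in> A"
    "\<And>N. (\<delta> * b) ^ N = (\<Sum>g\<in>G. c N g * g)" by metis
  \<comment> \<open>The \<open>card G + 1\<close> powers of \<open>\<delta> * b\<close> have
    coordinates with respect to only \<open>card G\<close> generators, so they are linearly
    dependent.\<close>
  have "\<exists>e. (\<forall>N\<in>{..card G}. e N \<in> A) \<and> (\<exists>N\<in>{..card G}. e N \<noteq> 0) \<and>
      (\<forall>g\<in>G. (\<Sum>N\<in>{..card G}. c N g * e N) = 0)"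
    by (intro homogeneous_system_nontrivial_solution) (auto simp: G c)
  then obtain e where e: "\<And>N. N \<le> card G \<Longrightarrow> e N \<in> A" "\<exists>N\<le>card G. e N \<noteq> 0"
    "\<And>g. g \<in> G \<Longrightarrow> (\<Sum>N\<le>card G. c N g * e N) = 0" by auto
  define p where "p = (\<Sum>N\<le>card G. Polynomial.monom (e N * \<delta> ^ N) N)"
  have coeff_p: "Polynomial.coeff p N = (if N \<le> card G then e N * \<delta> ^ N else 0)" for N
    by (simp add: p_def coeff_sum)
  have "poly p b = (\<Sum>N\<le>card G. e N * (\<delta> * b) ^ N)"
    by (simp add: p_def poly_sum poly_monom power_mult_distrib mult.assoc)
  also have "\<dots> = (\<Sum>N\<le>card G. \<Sum>g\<in>G. g * (c N g * e N))"
    unfolding c(2) by (simp add: sum_distrib_left mult_ac)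
  also have "\<dots> = (\<Sum>g\<in>G. g * (\<Sum>N\<le>card G. c N g * e N))"
    by (subst sum.swap) (simp add: sum_distrib_left)
  also have "\<dots> = 0" using e(3) by simp
  finally have "poly p b = 0" .
  moreover have "p \<noteq> 0"
  proof -
    obtain N where "N \<le> card G" "e N \<noteq> 0" using e(2) by auto
    then have "Polynomial.coeff p N \<noteq> 0" using G by (simp add: coeff_p)
    then show ?thesis by auto
  qed
  moreover have "Polynomial.coeff p N \<in> A" for N
    using e(1) G by (auto simp: coeff_p zero_closed intro: mult_closed power_closed)
  ultimately show "algebraic_over A b" by (auto simp: algebraic_over_def)
qed

text \<open>A linear polynomial suffices. This covers elements, such as the kernel with its negative
  exponents, that enter \<open>A\<close> after multiplication by a monomial.\<close>

lemma algebraic_over_multiple: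
  assumes "a \<in> A" "a \<noteq> 0" "a * b \<in> A"
  shows "algebraic_over A b"
  unfolding algebraic_over_def
  by (rule exI[of _ "[:- (a * b), a:]"])
     (use assms in \<open>auto simp: coeff_pCons zero_closed uminus_closed split: nat.split\<close>)

lemma algebraic_over_base: "a \<in> A \<Longrightarrow> algebraic_over A a"
  by (rule algebraic_over_multiple[of 1]) (auto simp: one_closed)

text \<open>The products of the generators of two spans generate one span that both multiplications
  preserve, up to \<open>\<delta>\<close> and \<open>\<epsilon>\<close>; sum and product then
  preserve it up to \<open>\<delta> * \<epsilon>\<close>.\<close>

lemma algebraic_over_add_mult:
  assumes "algebraic_over A a" "algebraic_over A b"
  shows "algebraic_over A (a + b)" "algebraic_over A (a * b)"
proof -
  obtain G \<delta> where G: "finite G" "1 \<in> G" "\<delta> \<in> A" "\<delta> \<noteq> 0"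
    "\<And>g. g \<in> G \<Longrightarrow> \<delta> * a * g \<in> span_over A G"
    using assms(1) by (auto simp: algebraic_over_iff_span)
  obtain H \<epsilon> where H: "finite H" "1 \<in> H" "\<epsilon> \<in> A" "\<epsilon> \<noteq> 0"
    "\<And>h. h \<in> H \<Longrightarrow> \<epsilon> * b * h \<in> span_over A H"
    using assms(2) by (auto simp: algebraic_over_iff_span)
  define P where "P = (\<lambda>(g, h). g * h) ` (G \<times> H)"
  have P: "finite P" "1 \<in> P"
    using G H by (auto simp: P_def image_iff intro!: bexI[of _ 1])
  have P_I: "g * h \<in> span_over A P" if "g \<in> G" "h \<in> H" for g h
    using that P by (intro span_base) (auto simp: P_def)
  have a: "\<delta> * a * x \<in> span_over A P" if x: "x \<in> span_over A P" for x
  proof (rule span_mult_subset[OF x])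
    fix y assume "y \<in> P"
    then obtain g h where gh: "g \<in> G" "h \<in> H" "y = g * h" by (auto simp: P_def)
    have "h * (\<delta> * a * g) \<in> span_over A P"
      by (rule span_mult_subset[OF G(5)[OF gh(1)]]) (use gh P_I in \<open>auto simp: mult.commute\<close>)
    then show "\<delta> * a * y \<in> span_over A P" by (simp add: gh algebra_simps)
  qed
  have b: "\<epsilon> * b * x \<in> span_over A P" if x: "x \<in> span_over A P" for x
  proof (rule span_mult_subset[OF x])
    fix y assume "y \<in> P"
    then obtain g h where gh: "g \<in> G" "h \<in> H" "y = g * h" by (auto simp: P_def)
    have "g * (\<epsilon> * b * h) \<in> span_over A P"
      by (rule span_mult_subset[OF H(5)[OF gh(2)]]) (use gh P_I in auto)
    then show "\<epsilon> * b * y \<in> span_over A P" by (simp add: gh algebra_simps)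
  qed
  have \<delta>\<epsilon>: "\<delta> * \<epsilon> \<in> A" "\<delta> * \<epsilon> \<noteq> 0" using G H by (auto intro: mult_closed)
  have "\<delta> * \<epsilon> * (a + b) * y \<in> span_over A P" if "y \<in> P" for y
  proof -
    have "\<epsilon> * (\<delta> * a * y) + \<delta> * (\<epsilon> * b * y) \<in> span_over A P"
      using that G H P by (intro span_add span_scale a b span_base)
    then show ?thesis by (simp add: algebra_simps)
  qed
  then show "algebraic_over A (a + b)"
    using P \<delta>\<epsilon> unfolding algebraic_over_iff_span by blast
  have "\<delta> * \<epsilon> * (a * b) * y \<in> span_over A P" if "y \<in> P" for y
    using a[OF b[OF span_base[OF P(1) that]]] by (simp add: algebra_simps)
  then show "algebraic_over A (a * b)"
    using P \<delta>\<epsilon> unfolding algebraic_over_iff_span by blast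
qed

lemma subdomain_of_algebraics: "subdomain_of {b. algebraic_over A b}"
proof -
  have "algebraic_over A (- a)" if "algebraic_over A a" for a
    using algebraic_over_add_mult(2)[OF algebraic_over_base[OF uminus_closed[OF one_closed]] that]
    by simp
  then show ?thesis
    by unfold_locales (auto intro: algebraic_over_add_mult algebraic_over_base one_closed)
qed

text \<open>Take a span preserved by \<open>b ^ 2\<close> up to \<open>\<delta>\<close> and adjoin
  \<open>b * g\<close> for each generator \<open>g\<close>: multiplication by \<open>b\<close> sends
  old generators to new ones, and new ones back into the old span.\<close>

lemma algebraic_over_sqrt:
  assumes "algebraic_over A (b ^ 2)"
  shows "algebraic_over A b"
proof -
  obtain G \<delta> where G: "finite G" "1 \<in> G" "\<delta> \<in> A" "\<delta> \<noteq> 0"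
    "\<And>g. g \<in> G \<Longrightarrow> \<delta> * b ^ 2 * g \<in> span_over A G"
    using assms by (auto simp: algebraic_over_iff_span)
  define H where "H = G \<union> (\<lambda>g. b * g) ` G"
  have H: "finite H" "1 \<in> H" using G by (auto simp: H_def)
  have "\<delta> * b * h \<in> span_over A H" if h: "h \<in> H" for h
  proof (cases "h \<in> G")
    case True
    have "\<delta> * (b * h) \<in> span_over A H"
      using True H G by (intro span_scale span_base) (auto simp: H_def)
    then show ?thesis by (simp add: mult.assoc)
  next
    case False
    with h obtain g where g: "g \<in> G" "h = b * g" by (auto simp: H_def)
    have "1 * (\<delta> * b ^ 2 * g) \<in> span_over A H"
      by (rule span_mult_subset[OF G(5)[OF g(1)]]) (use H in \<open>auto intro!: span_base simp: H_def\<close>)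
    then show ?thesis by (simp add: g power2_eq_square mult.assoc)
  qed
  then show ?thesis using H G unfolding algebraic_over_iff_span by blast
qed

text \<open>The polynomial with reversed coefficients annihilates the inverse. Its constant
  coefficient is the old leading one, so it is not 0.\<close>

lemma algebraic_over_inverse:
  assumes "algebraic_over A b" "a * b = 1"
  shows "algebraic_over A a"
proof -
  from assms obtain p where p: "p \<noteq> 0" "\<And>i. Polynomial.coeff p i \<in> A" "poly p b = 0"
    by (auto simp: algebraic_over_def)
  define n where "n = Polynomial.degree p"
  define q where "q = (\<Sum>k\<le>n. Polynomial.monom (Polynomial.coeff p k) (n - k))"
  have "poly q a = (\<Sum>k\<le>n. Polynomial.coeff p k * a ^ (n - k))"
    by (simp add: q_def poly_sum poly_monom)
  also have "\<dots> = (\<Sum>k\<le>n. a ^ n * (Polynomial.coeff p k * b ^ k))"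
  proof (rule sum.cong)
    fix k assume "k \<in> {..n}"
    then have "a ^ n * b ^ k = a ^ (n - k) * (a * b) ^ k"
      by (simp add: power_mult_distrib power_add[symmetric] mult.assoc[symmetric])
    then show "Polynomial.coeff p k * a ^ (n - k) = a ^ n * (Polynomial.coeff p k * b ^ k)"
      using assms(2) by (simp add: algebra_simps)
  qed simp
  also have "\<dots> = a ^ n * poly p b"
    by (simp add: poly_altdef n_def sum_distrib_left)
  finally have "poly q a = 0" using p by simp
  moreover have coeff_q: "Polynomial.coeff q i = (if i \<le> n then Polynomial.coeff p (n - i) else 0)" for i
  proof -
    have "Polynomial.coeff q i = (\<Sum>k\<le>n. if k = n - i \<and> i \<le> n then Polynomial.coeff p k else 0)"
      by (auto simp: q_def coeff_sum intro!: sum.cong)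
    also have "\<dots> = (if i \<le> n then Polynomial.coeff p (n - i) else 0)"
      by (cases "i \<le> n") (auto simp: sum.delta)
    finally show ?thesis .
  qed
  have "Polynomial.coeff q 0 \<noteq> 0" using p(1) by (simp add: coeff_q n_def)
  then have "q \<noteq> 0" by auto
  moreover have "Polynomial.coeff q i \<in> A" for i
    using p(2) by (auto simp: coeff_q zero_closed)
  ultimately show ?thesis by (auto simp: algebraic_over_def)
qed

end

section \<open>Algebraicity of the coefficients of a factor\<close>

lemma algebraic_over_mono: "algebraic_over A b \<Longrightarrow> A \<subseteq> B \<Longrightarrow> algebraic_over B b"
  unfolding algebraic_over_def by blast


text \<open>Roots of \<open>f\<close> are roots of \<open>Q\<close>, hence algebraic, and
  \<open>f\<close> is its leading coefficient times a product over its roots. As the roots determine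
  \<open>f\<close> only up to a scalar, the leading coefficient has its own hypothesis.\<close>

lemma algebraic_over_coeff_factor_alg_closed:
  fixes f Q :: "'a::alg_closed_field poly"
  assumes "subdomain_of A"
  assumes "f dvd Q" "Q \<noteq> 0" "\<And>i. Polynomial.coeff Q i \<in> A" "algebraic_over A (Polynomial.lead_coeff f)"
  shows "algebraic_over A (Polynomial.coeff f i)"
proof -
  interpret subdomain_of A by fact
  interpret alg: subdomain_of "{b. algebraic_over A b}" by (rule subdomain_of_algebraics)
  have "f \<noteq> 0" using assms by auto
  then obtain M where M: "f = Polynomial.smult (Polynomial.lead_coeff f) (\<Prod>x\<in>#M. [:-x, 1:])"
    using alg_closed_imp_factorization by blast
  have "algebraic_over A x" if "x \<in># M" for x
  proof -
    have "[:-x, 1:] dvd f"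
      by (subst M, rule dvd_smult) (use that in \<open>auto intro: dvd_prod_mset\<close>)
    then have "poly Q x = 0" using assms(2) by (meson dvd_trans poly_eq_0_iff_dvd)
    with assms show ?thesis by (auto simp: algebraic_over_def)
  qed
  then have "Polynomial.coeff (\<Prod>x\<in>#M. [:-x, 1:]) i \<in> {b. algebraic_over A b}"
    by (intro alg.coeff_prod_linear_closed) auto
  with alg.mult_closed[of "Polynomial.lead_coeff f"] assms(5) show ?thesis
    by (subst M) simp
qed

text \<open>Over a domain \<open>f\<close> need not split, so the factorization is carried along the
  embedding \<open>\<iota>\<close> into an algebraic closure of the fraction field.\<close>

lemma algebraic_over_coeff_factor:
  fixes f g Q :: "'a::idom poly"
  assumes "subdomain_of A"
  assumes "Q = f * g" "Q \<noteq> 0" "\<And>i. Polynomial.coeff Q i \<in> A" "algebraic_over A (Polynomial.lead_coeff f)"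
  shows "algebraic_over A (Polynomial.coeff f i)"
proof -
  interpret subdomain_of A by fact
  define \<iota> :: "'a \<Rightarrow> 'a fract alg_closure" where "\<iota> a = to_ac (to_fract a)" for a
  have \<iota>: "\<iota> 0 = 0" "\<iota> 1 = 1" "\<iota> (a + b) = \<iota> a + \<iota> b" "\<iota> (a * b) = \<iota> a * \<iota> b" "\<iota> (- a) = - \<iota> a"
    "\<iota> a = \<iota> b \<longleftrightarrow> a = b" for a b
    by (auto simp: \<iota>_def)
  have \<iota>_sum: "\<iota> (\<Sum>i\<in>I. h i) = (\<Sum>i\<in>I. \<iota> (h i))" for h :: "nat \<Rightarrow> 'a" and I
    by (induction I rule: infinite_finite_induct) (auto simp: \<iota>)
  have \<iota>_pow: "\<iota> (a ^ n) = \<iota> a ^ n" for a n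
    by (induction n) (auto simp: \<iota>)
  have coeff: "Polynomial.coeff (map_poly \<iota> p) i = \<iota> (Polynomial.coeff p i)" for p i
    by (rule coeff_map_poly) (rule \<iota>)
  have mult: "map_poly \<iota> (p * q) = map_poly \<iota> p * map_poly \<iota> q" for p q
    by (rule poly_eqI) (simp add: coeff Polynomial.coeff_mult \<iota>_sum \<iota>)
  have deg: "Polynomial.degree (map_poly \<iota> p) = Polynomial.degree p" for p
    by (rule degree_map_poly) (metis \<iota>(1,6))
  have poly: "poly (map_poly \<iota> p) (\<iota> a) = \<iota> (poly p a)" for p a
    by (simp add: poly_altdef deg coeff \<iota>_sum \<iota> \<iota>_pow)
  have zero: "map_poly \<iota> p = 0 \<longleftrightarrow> p = 0" for p
    by (metis \<iota>(1,6) coeff coeff_0 poly_eqI)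
  \<comment> \<open>Annihilating polynomials transfer both ways: one with coefficients in the image
    of \<open>A\<close> is pulled back coefficientwise, by injectivity of
    \<open>\<iota>\<close>.\<close>
  have alg_iff: "algebraic_over (\<iota> ` A) (\<iota> a) \<longleftrightarrow> algebraic_over A a" for a
  proof
    assume "algebraic_over (\<iota> ` A) (\<iota> a)"
    then obtain p where p: "p \<noteq> 0" "\<And>i. Polynomial.coeff p i \<in> \<iota> ` A" "poly p (\<iota> a) = 0"
      by (auto simp: algebraic_over_def)
    define \<kappa> where "\<kappa> = inv_into UNIV \<iota>"
    have \<kappa>: "\<kappa> (\<iota> b) = b" for b
      unfolding \<kappa>_def by (rule inv_f_f) (auto simp: inj_on_def \<iota>)
    have "\<kappa> 0 = 0" using \<kappa>[of 0] by (simp add: \<iota>)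
    define q where "q = map_poly \<kappa> p"
    have cq: "Polynomial.coeff q i = \<kappa> (Polynomial.coeff p i)" for i
      unfolding q_def by (rule coeff_map_poly) fact
    have pq: "p = map_poly \<iota> q"
    proof (rule poly_eqI)
      fix i
      show "Polynomial.coeff p i = Polynomial.coeff (map_poly \<iota> q) i"
        using p(2)[of i] by (auto simp: coeff cq \<kappa>)
    qed
    have "q \<noteq> 0" using p(1) by (simp add: pq zero)
    moreover have "poly q a = 0" using p(3) unfolding pq poly by (metis \<iota>(1,6))
    moreover have "Polynomial.coeff q i \<in> A" for i using p(2)[of i] by (auto simp: cq \<kappa>)
    ultimately show "algebraic_over A a" by (auto simp: algebraic_over_def)
  next
    assume "algebraic_over A a"
    then obtain p where p: "p \<noteq> 0" "\<And>i. Polynomial.coeff p i \<in> A" "poly p a = 0"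
      by (auto simp: algebraic_over_def)
    then show "algebraic_over (\<iota> ` A) (\<iota> a)"
      unfolding algebraic_over_def
      by (intro exI[of _ "map_poly \<iota> p"]) (auto simp: zero coeff poly \<iota>)
  qed
  have "subdomain_of (\<iota> ` A)"
  proof unfold_locales
    show "1 \<in> \<iota> ` A" using one_closed \<iota>(2) by (metis imageI)
  next
    fix a b assume "a \<in> \<iota> ` A" "b \<in> \<iota> ` A"
    then show "a + b \<in> \<iota> ` A" "a * b \<in> \<iota> ` A"
      by (auto simp: \<iota>(3,4)[symmetric] intro: add_closed mult_closed)
  next
    fix a assume "a \<in> \<iota> ` A"
    then show "- a \<in> \<iota> ` A" by (auto simp: \<iota>(5)[symmetric] intro: uminus_closed)
  qed
  then have "algebraic_over (\<iota> ` A) (Polynomial.coeff (map_poly \<iota> f) i)"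
  proof (rule algebraic_over_coeff_factor_alg_closed)
    show "map_poly \<iota> f dvd map_poly \<iota> Q" using assms(2) by (simp add: mult)
    show "map_poly \<iota> Q \<noteq> 0" using assms(3) by (simp add: zero)
    show "Polynomial.coeff (map_poly \<iota> Q) i \<in> \<iota> ` A" for i using assms(4) by (simp add: coeff)
    show "algebraic_over (\<iota> ` A) (Polynomial.lead_coeff (map_poly \<iota> f))"
      using assms(5) by (simp add: coeff deg alg_iff)
  qed
  then show ?thesis by (simp add: coeff alg_iff)
qed

section \<open>Series with restricted exponents\<close>

text \<open>The lexicographic order on exponents makes Laurent polynomials an integral domain.\<close>

instance prod :: (linordered_ab_group_add, linordered_ab_group_add) ordered_cancel_comm_monoid_add
  by standard (auto simp: less_eq_prod_def)

text \<open>Exponent sets stand for the choice of variables: the half-axes give series in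
  \<open>x\<close> or in \<open>1/x\<close>, and \<open>{0}\<close> gives series in \<open>t\<close>
  alone. A set that contains 0 and is closed under addition yields a subring.\<close>

definition support_in :: "(int \<times> int) set \<Rightarrow> laurent fps set" where
  "support_in M = {F. \<forall>n. Poly_Mapping.keys (fps_nth F n) \<subseteq> M}"

lemma support_inD: "F \<in> support_in M \<Longrightarrow> k \<notin> M \<Longrightarrow> Poly_Mapping.lookup (fps_nth F n) k = 0"
  unfolding support_in_def by (metis (mono_tags, lifting) in_keys_iff mem_Collect_eq subsetD)

lemma support_inI: "(\<And>n k. k \<notin> M \<Longrightarrow> Poly_Mapping.lookup (fps_nth F n) k = 0) \<Longrightarrow> F \<in> support_in M"
  by (auto simp: support_in_def in_keys_iff)

lemma support_in_mono: "F \<in> support_in M \<Longrightarrow> M \<subseteq> N \<Longrightarrow> F \<in> support_in N"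
  by (auto simp: support_in_def)

lemma support_in_Int: "F \<in> support_in M \<Longrightarrow> F \<in> support_in N \<Longrightarrow> F \<in> support_in (M \<inter> N)"
  by (auto simp: support_in_def)

lemma support_in_add: "F \<in> support_in M \<Longrightarrow> G \<in> support_in M \<Longrightarrow> F + G \<in> support_in M"
  by (auto intro!: support_inI simp: lookup_add support_inD)

lemma support_in_uminus: "F \<in> support_in M \<Longrightarrow> - F \<in> support_in M"
  by (auto intro!: support_inI simp: support_inD)

lemma support_in_diff: "F \<in> support_in M \<Longrightarrow> G \<in> support_in M \<Longrightarrow> F - G \<in> support_in M"
  by (auto intro!: support_inI simp: lookup_minus support_inD)

lemma lookup_mult_eq_0:
  assumes "Poly_Mapping.keys p \<subseteq> M" "Poly_Mapping.keys q \<subseteq> N" "\<And>a b. a \<in> M \<Longrightarrow> b \<in> N \<Longrightarrow> a + b \<in> L"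
    and "k \<notin> L"
  shows "Poly_Mapping.lookup (p * q) k = 0"
proof (rule ccontr)
  assume "Poly_Mapping.lookup (p * q) k \<noteq> 0"
  then have "k \<in> Poly_Mapping.keys (p * q)" by (simp add: in_keys_iff)
  then obtain a b where "a \<in> Poly_Mapping.keys p" "b \<in> Poly_Mapping.keys q" "k = a + b"
    using keys_mult[of p q] by blast
  with assms show False by blast
qed

lemma support_in_mult:
  assumes "F \<in> support_in M" "G \<in> support_in N" "\<And>a b. a \<in> M \<Longrightarrow> b \<in> N \<Longrightarrow> a + b \<in> L"
  shows "F * G \<in> support_in L"
proof (rule support_inI)
  fix n k assume "k \<notin> L"
  then show "Poly_Mapping.lookup (fps_nth (F * G) n) k = 0"
    unfolding fps_mult_nth lookup_sum using assms
    by (intro sum.neutral ballI lookup_mult_eq_0[of _ M _ N L]) (auto simp: support_in_def)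
qed

lemma support_in_const: "fps_const p \<in> support_in M \<longleftrightarrow> Poly_Mapping.keys p \<subseteq> M"
  by (auto simp: support_in_def split: if_splits)

lemma support_in_one: "0 \<in> M \<Longrightarrow> 1 \<in> support_in M"
  by (auto simp: support_in_def)

lemma support_in_X: "0 \<in> M \<Longrightarrow> fps_X \<in> support_in M"
  by (auto simp: support_in_def)

lemma subdomain_of_support_in:
  assumes "0 \<in> M" "\<And>a b. a \<in> M \<Longrightarrow> b \<in> M \<Longrightarrow> a + b \<in> M"
  shows "subdomain_of (support_in M)"
  by unfold_locales (rule support_in_one[OF assms(1)], erule (1) support_in_add,
    erule (1) support_in_mult, erule (1) assms(2), erule support_in_uminus)

section \<open>Reciprocals and square roots of series\<close>

lemma recip_nth_0 [simp]: "fps_nth (recip F) 0 = 1"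
  by (simp add: recip_def)

lemma recip_unique: "fps_nth F 0 = 1 \<Longrightarrow> F * G = 1 \<Longrightarrow> recip F = G"
proof -
  assume "fps_nth F 0 = 1" and FG: "F * G = 1"
  then have "F * recip F = F * G" by (simp add: recip)
  moreover have "F \<noteq> 0" using FG by auto
  ultimately show "recip F = G" by simp
qed

lemma recip_recip: "fps_nth F 0 = 1 \<Longrightarrow> recip (recip F) = F"
  using recip[of F] by (intro recip_unique) (auto simp: mult.commute)

text \<open>Each coefficient of the reciprocal is a sum of products of coefficients of
  \<open>F\<close> with earlier ones of the reciprocal, so its exponents stay in
  \<open>M\<close>.\<close>

lemma recip_support_in:
  assumes "F \<in> support_in M" "fps_nth F 0 = 1" "0 \<in> M" "\<And>a b. a \<in> M \<Longrightarrow> b \<in> M \<Longrightarrow> a + b \<in> M"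
  shows "recip F \<in> support_in M"
proof -
  define G where "G = recip F"
  have FG: "F * G = 1" using recip assms(2) by (simp add: G_def)
  have "Poly_Mapping.lookup (fps_nth G n) k = 0" if "k \<notin> M" for n k
    using that
  proof (induction n arbitrary: k rule: less_induct)
    case (less n)
    show ?case
    proof (cases "n = 0")
      case True
      then show ?thesis using less.prems assms(3) by (auto simp: G_def lookup_one when_def)
    next
      case False
      have "0 = fps_nth (F * G) n" using False by (simp add: FG)
      also have "\<dots> = fps_nth G n + (\<Sum>i=1..n. fps_nth F i * fps_nth G (n - i))"
        by (simp add: fps_mult_nth sum.atLeast_Suc_atMost assms(2))
      finally have "fps_nth G n = - (\<Sum>i=1..n. fps_nth F i * fps_nth G (n - i))"
        by (simp add: eq_neg_iff_add_eq_0)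
      moreover have "Poly_Mapping.lookup (fps_nth F i * fps_nth G (n - i)) k = 0" if "i \<in> {1..n}" for i
      proof (rule lookup_mult_eq_0[of _ M _ M M])
        show "Poly_Mapping.keys (fps_nth G (n - i)) \<subseteq> M"
          using less.IH[of "n - i"] that by (auto simp: in_keys_iff)
        show "Poly_Mapping.keys (fps_nth F i) \<subseteq> M" using assms(1) by (auto simp: support_in_def)
      qed (fact assms(4) less.prems)+
      ultimately show ?thesis by (simp add: lookup_sum)
    qed
  qed
  then show ?thesis by (auto simp: G_def intro: support_inI)
qed

text \<open>In a domain two square roots differ at most by a sign. Here their sum has constant term
  2, which rules out the minus sign.\<close>

lemma sqrt_fps_unique:
  assumes "G ^ 2 = F" "fps_nth G 0 = 1"
  shows "sqrt_fps F = G"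
  unfolding sqrt_fps_def
proof (rule the_equality)
  fix H assume H: "H ^ 2 = F \<and> fps_nth H 0 = 1"
  have "(H - G) * (H + G) = 0" using H assms by (simp add: algebra_simps power2_eq_square)
  moreover have "fps_nth (H + G) 0 \<noteq> 0" using H assms by simp
  then have "H + G \<noteq> 0" by (metis fps_zero_nth)
  ultimately show "H = G" by simp
qed (use assms in auto)

section \<open>Extraction of the terms with prescribed exponents\<close>

definition restrict_keys :: "(int \<times> int) set \<Rightarrow> laurent \<Rightarrow> laurent" where
  "restrict_keys M p = (\<Sum>k\<in>Poly_Mapping.keys p \<inter> M. Poly_Mapping.single k (Poly_Mapping.lookup p k))"

lemma lookup_restrict_keys:
  "Poly_Mapping.lookup (restrict_keys M p) k = (if k \<in> M then Poly_Mapping.lookup p k else 0)"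
proof -
  have "Poly_Mapping.lookup (restrict_keys M p) k =
      (\<Sum>l\<in>Poly_Mapping.keys p \<inter> M. if l = k then Poly_Mapping.lookup p l else 0)"
    unfolding restrict_keys_def lookup_sum by (intro sum.cong) (auto simp: lookup_single)
  also have "\<dots> = (if k \<in> M then Poly_Mapping.lookup p k else 0)"
    by (auto simp: sum.delta in_keys_iff)
  finally show ?thesis .
qed

definition proj :: "(int \<times> int) set \<Rightarrow> laurent fps \<Rightarrow> laurent fps" where
  "proj M F = Abs_fps (\<lambda>n. restrict_keys M (fps_nth F n))"

lemma lookup_proj:
  "Poly_Mapping.lookup (fps_nth (proj M F) n) k = (if k \<in> M then Poly_Mapping.lookup (fps_nth F n) k else 0)"
  by (simp add: proj_def lookup_restrict_keys)

lemma laurent_fps_eqI: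
  "(\<And>n k. Poly_Mapping.lookup (fps_nth F n) k = Poly_Mapping.lookup (fps_nth G n) k) \<Longrightarrow> F = G"
  by (auto simp: fps_eq_iff intro: poly_mapping_eqI)

lemma proj_add: "proj M (F + G) = proj M F + proj M G"
  by (rule laurent_fps_eqI) (simp add: lookup_proj lookup_add)

lemma proj_diff: "proj M (F - G) = proj M F - proj M G"
  by (rule laurent_fps_eqI) (simp add: lookup_proj lookup_minus)

lemma proj_id: "F \<in> support_in M \<Longrightarrow> proj M F = F"
  by (rule laurent_fps_eqI) (auto simp: lookup_proj support_inD)

lemma proj_eq_0: "F \<in> support_in N \<Longrightarrow> N \<inter> M = {} \<Longrightarrow> proj M F = 0"
  by (rule laurent_fps_eqI) (auto simp: lookup_proj disjoint_iff intro: support_inD)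

lemma proj_support: "F \<in> support_in N \<Longrightarrow> proj M F \<in> support_in (N \<inter> M)"
  by (rule support_inI) (auto simp: lookup_proj support_inD)

lemma diff_proj_support: "F \<in> support_in N \<Longrightarrow> F - proj M F \<in> support_in (N - M)"
  by (rule support_inI) (auto simp: lookup_proj lookup_minus support_inD)

lemma support_in_UNIV: "F \<in> support_in UNIV"
  by (simp add: support_in_def)

text \<open>Translation by an exponent in \<open>N\<close> preserves \<open>M\<close> and its
  complement, so the two parts of \<open>F\<close> do not mix. For the axis: extracting
  \<open>y^0\<close> is linear over series in \<open>x\<close>.\<close>

lemma proj_mult_right:
  assumes "G \<in> support_in N"
    and "\<And>a b. b \<in> N \<Longrightarrow> a + b \<in> M \<longleftrightarrow> a \<in> M"
  shows "proj M (F * G) = proj M F * G"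
proof -
  have "F * G = proj M F * G + (F - proj M F) * G" by (simp add: algebra_simps)
  moreover have "proj M F * G \<in> support_in M"
    using proj_support[OF support_in_UNIV, of M F] assms
    by (intro support_in_mult[of _ M G N]) (simp, blast+)
  moreover have "(F - proj M F) * G \<in> support_in (- M)"
    using diff_proj_support[OF support_in_UNIV, of F M] assms
    by (intro support_in_mult[of _ "- M" G N]) (simp add: Compl_eq_Diff_UNIV, blast+)
  then have "proj M ((F - proj M F) * G) = 0" by (rule proj_eq_0) auto
  ultimately show ?thesis by (metis proj_add proj_id add.right_neutral)
qed

text \<open>A sum of two exponents in \<open>N\<close> lies in \<open>Z\<close> only if both do, so
  cross terms do not contribute. With \<open>Z = {0}\<close>, taking the constant term is
  multiplicative on series in \<open>x\<close> alone or in \<open>1/x\<close> alone, as evaluation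
  at 0 must be.\<close>

lemma proj_mult:
  assumes "F \<in> support_in N" "G \<in> support_in N"
    and "\<And>a b. a \<in> N \<Longrightarrow> b \<in> N \<Longrightarrow> a + b \<in> Z \<longleftrightarrow> a \<in> Z \<and> b \<in> Z"
  shows "proj Z (F * G) = proj Z F * proj Z G"
proof -
  define F' where "F' = F - proj Z F"
  define G' where "G' = G - proj Z G"
  have F: "F = proj Z F + F'" and G: "G = proj Z G + G'" by (auto simp: F'_def G'_def)
  note s = proj_support[OF assms(1), of Z] proj_support[OF assms(2), of Z]
  note s' = diff_proj_support[OF assms(1), of Z, folded F'_def]
    diff_proj_support[OF assms(2), of Z, folded G'_def]
  have "F * G = proj Z F * proj Z G + (proj Z F * G' + F' * G)"
    by (simp add: algebra_simps G'_def F'_def)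
  moreover have "proj Z F * proj Z G \<in> support_in Z"
    by (rule support_in_mult[OF s]) (use assms(3) in blast)
  moreover have "proj Z F * G' \<in> support_in (- Z)"
    by (rule support_in_mult[OF s(1) s'(2)]) (use assms(3) in blast)
  moreover have "F' * G \<in> support_in (- Z)"
    by (rule support_in_mult[OF s'(1) assms(2)]) (use assms(3) in blast)
  ultimately show ?thesis
    using proj_eq_0[of _ "- Z" Z] by (simp add: proj_add proj_id)
qed

section \<open>First passage decomposition\<close>

text \<open>The index starts at 1: the starting point is exempt, since the origin may belong to
  \<open>F\<close>, as it does for the slit.\<close>

definition avoids :: "(int \<times> int) set \<Rightarrow> (int \<times> int) list \<Rightarrow> bool" where
  "avoids F w \<longleftrightarrow> (\<forall>k. 1 \<le> k \<and> k < length w \<longrightarrow> w ! k \<notin> F)"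

text \<open>At least one step is required, so the start never counts as a hit and the series has no
  term in \<open>t^0\<close>.\<close>

definition first_hits :: "(int \<times> int) set \<Rightarrow> (int \<times> int) list \<Rightarrow> bool" where
  "first_hits F w \<longleftrightarrow> 2 \<le> length w \<and> last w \<in> F \<and> avoids F (butlast w)"

definition step_sum :: "(int \<times> int) set \<Rightarrow> laurent" where
  "step_sum S = (\<Sum>s\<in>S. Poly_Mapping.single s 1)"

lemma avoids_snoc: "w \<noteq> [] \<Longrightarrow> avoids F (w @ [p]) \<longleftrightarrow> avoids F w \<and> p \<notin> F"
  unfolding avoids_def by (auto simp: nth_append less_Suc_eq Suc_le_eq)

lemma walks_length_1: "{w \<in> walks S. length w = 0 + 1} = {[(0, 0)]}"
  by (auto simp: walks_def length_Suc_conv)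

lemma walks_length_Suc:
  "{w \<in> walks S. length w = Suc n + 1} =
     (\<lambda>(w, s). w @ [last w + s]) ` ({w \<in> walks S. length w = n + 1} \<times> S)" (is "?L = ?R")
proof (intro equalityI subsetI)
  fix w assume w: "w \<in> ?L"
  define v where "v = butlast w"
  have v: "length v = n + 1" "w = v @ [last w]"
    using w by (auto simp: v_def walks_def)
  have ne: "v \<noteq> []" using v(1) by auto
  have "v ! k = w ! k" if "k < length v" for k
    using that by (simp add: v_def nth_butlast)
  then have "v \<in> walks S" using w v ne by (auto simp: walks_def)
  moreover have "w ! (n + 1) - w ! n \<in> S"
    using w unfolding walks_def by force
  moreover have "w ! (n + 1) = last w" "w ! n = last v"
    using ne by (subst v(2), simp add: nth_append v(1) last_conv_nth)+
  ultimately show "w \<in> ?R"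
    using v by (intro image_eqI[of _ _ "(v, last w - last v)"]) auto
next
  fix w assume "w \<in> ?R"
  then obtain v s where v: "v \<in> walks S" "length v = n + 1" "s \<in> S" "w = v @ [last v + s]" by auto
  have "v \<noteq> []" using v by auto
  then have "w ! k - w ! (k - 1) \<in> S" if "1 \<le> k" "k < length w" for k
    using that v by (cases "k = n + 1") (auto simp: nth_append walks_def last_conv_nth)
  with v \<open>v \<noteq> []\<close> show "w \<in> ?L" by (auto simp: walks_def nth_append)
qed

lemma finite_walks: "finite S \<Longrightarrow> finite {w \<in> walks S. length w = n + 1}"
proof (induction n)
  case 0
  then show ?case using walks_length_1[of S] by simp
next
  case (Suc n)
  then show ?case unfolding walks_length_Suc by auto
qed

text \<open>Regrouping by endpoint turns counts into a sum over walks, in which appending a step is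
  multiplication by a monomial.\<close>

lemma walk_gf_nth:
  assumes "finite S" "W \<subseteq> walks S"
  shows "fps_nth (walk_gf W) n = (\<Sum>w\<in>{w \<in> W. length w = n + 1}. Poly_Mapping.single (last w) 1)"
proof -
  let ?W = "{w \<in> W. length w = n + 1}"
  have fin: "finite ?W"
    by (rule finite_subset[OF _ finite_walks[OF assms(1), of n]]) (use assms in auto)
  have "fps_nth (walk_gf W) n =
      (\<Sum>p\<in>last ` ?W. \<Sum>w\<in>{w \<in> ?W. last w = p}. Poly_Mapping.single (last w) (1::real))"
    by (simp add: walk_gf_def num_walks_def Defs.mon_def conj_assoc case_prod_unfold)
  also have "\<dots> = (\<Sum>w\<in>?W. Poly_Mapping.single (last w) 1)"
    using fin by (intro sum.group) auto
  finally show ?thesis .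
qed

lemma walk_gf_support_in:
  assumes "finite S" "W \<subseteq> walks S" "\<And>w. w \<in> W \<Longrightarrow> last w \<in> M"
  shows "walk_gf W \<in> support_in M"
proof (rule support_inI)
  fix n k assume "k \<notin> M"
  with assms(3) have "last w \<noteq> k" if "w \<in> W" for w using that by blast
  then show "Poly_Mapping.lookup (fps_nth (walk_gf W) n) k = 0"
    by (auto simp: walk_gf_nth[OF assms(1,2)] lookup_sum lookup_single when_def intro!: sum.neutral)
qed

lemma proj_walk_gf:
  assumes "finite S" "W \<subseteq> walks S"
  shows "proj M (walk_gf W) = walk_gf {w \<in> W. last w \<in> M}"
proof (rule laurent_fps_eqI)
  fix n k
  let ?W = "{w \<in> W. length w = n + 1}"
  have fin: "finite ?W"
    by (rule finite_subset[OF _ finite_walks[OF assms(1), of n]]) (use assms in auto)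
  have "Poly_Mapping.lookup (fps_nth (walk_gf {w \<in> W. last w \<in> M}) n) k =
      (\<Sum>w\<in>{w \<in> ?W. last w \<in> M}. Poly_Mapping.lookup (Poly_Mapping.single (last w) 1) k)"
    by (subst walk_gf_nth[OF assms(1)])
      (use assms in \<open>auto simp: lookup_sum conj_ac intro!: arg_cong2[of _ _ _ _ sum]\<close>)
  also have "\<dots> = (\<Sum>w\<in>?W. if last w \<in> M then Poly_Mapping.lookup (Poly_Mapping.single (last w) 1) k else 0)"
    using fin by (intro sum.mono_neutral_cong_left) auto
  also have "\<dots> = (\<Sum>w\<in>?W. if k \<in> M then Poly_Mapping.lookup (Poly_Mapping.single (last w) 1) k else 0)"
    by (intro sum.cong) (auto simp: lookup_single when_def)
  also have "\<dots> = Poly_Mapping.lookup (fps_nth (proj M (walk_gf W)) n) k"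
    by (simp add: lookup_proj walk_gf_nth[OF assms] lookup_sum)
  finally show "Poly_Mapping.lookup (fps_nth (proj M (walk_gf W)) n) k =
    Poly_Mapping.lookup (fps_nth (walk_gf {w \<in> W. last w \<in> M}) n) k" ..
qed

text \<open>Appending a step to an \<open>F\<close>-avoiding walk produces, exactly once each, the
  nontrivial walks that avoid \<open>F\<close> or meet it for the first time at their end. The
  identity records this for consecutive lengths.\<close>

lemma walk_gf_first_passage:
  assumes "finite S"
  shows "walk_gf {w \<in> walks S. avoids F w} * (1 - fps_X * fps_const (step_sum S)) =
    1 - walk_gf {w \<in> walks S. first_hits F w}" (is "?a * _ = 1 - ?h")
proof -
  have nth: "fps_nth (walk_gf {w \<in> walks S. P w}) n =
      (\<Sum>w\<in>{w \<in> walks S. P w \<and> length w = n + 1}. Poly_Mapping.single (last w) 1)" for P n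
    using assms by (subst walk_gf_nth[of S]) (auto simp: conj_assoc)
  have "fps_nth (?a * (1 - fps_X * fps_const (step_sum S))) n = fps_nth (1 - ?h) n" for n
  proof (cases n)
    case 0
    have "{w \<in> walks S. avoids F w \<and> length w = 0 + 1} = {[(0, 0)]}"
    proof -
      have "{w \<in> walks S. avoids F w \<and> length w = 0 + 1} =
          {w \<in> {w \<in> walks S. length w = 0 + 1}. avoids F w}" by blast
      also have "\<dots> = {[(0, 0)]}" unfolding walks_length_1 by (auto simp: avoids_def)
      finally show ?thesis .
    qed
    then have "fps_nth ?a 0 = 1" by (subst nth) (simp add: zero_prod_def[symmetric])
    moreover have "{w \<in> walks S. first_hits F w \<and> length w = 0 + 1} = {}"
      by (auto simp: first_hits_def)
    then have "fps_nth ?h 0 = 0" by (simp only: nth sum.empty)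
    ultimately show ?thesis using 0 by (simp add: algebra_simps)
  next
    case (Suc m)
    let ?V = "{v \<in> walks S. avoids F v \<and> length v = m + 1}"
    let ?A = "{w \<in> walks S. avoids F w \<and> length w = n + 1}"
    let ?H = "{w \<in> walks S. first_hits F w \<and> length w = n + 1}"
    let ?f = "\<lambda>(w, s). w @ [last w + s]"
    have union: "?A \<union> ?H = ?f ` (?V \<times> S)"
    proof -
      have "?A \<union> ?H = {w \<in> {w \<in> walks S. length w = Suc m + 1}. avoids F (butlast w)}"
      proof (rule Set.set_eqI)
        fix w :: "(int \<times> int) list"
        have "w = butlast w @ [last w]" "butlast w \<noteq> []" if "length w = Suc m + 1"
          using that by (auto simp: length_Suc_conv)
        then have "avoids F w \<or> first_hits F w \<longleftrightarrow> avoids F (butlast w)" if "length w = Suc m + 1"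
          using that avoids_snoc[of "butlast w" F "last w"] by (auto simp: first_hits_def)
        then show "w \<in> ?A \<union> ?H \<longleftrightarrow>
            w \<in> {w \<in> {w \<in> walks S. length w = Suc m + 1}. avoids F (butlast w)}"
          using Suc by auto
      qed
      also have "\<dots> = ?f ` (?V \<times> S)"
        unfolding walks_length_Suc by force
      finally show ?thesis .
    qed
    have disj: "?A \<inter> ?H = {}"
    proof -
      have False if "avoids F w" "first_hits F w" for w
      proof -
        have "w = butlast w @ [last w]" "butlast w \<noteq> []"
          using that(2) by (auto simp: first_hits_def simp flip: length_greater_0_conv)
        then show False using that avoids_snoc[of "butlast w" F "last w"] by (auto simp: first_hits_def)
      qed
      then show ?thesis by blast
    qed
    have fin: "finite ?A" "finite ?H"
      by (rule finite_subset[OF _ finite_walks[OF assms, of n]]; auto)+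
    have "fps_nth ?a n + fps_nth ?h n = (\<Sum>w\<in>?A \<union> ?H. Poly_Mapping.single (last w) 1)"
      by (simp only: nth sum.union_disjoint[OF fin disj])
    also have "\<dots> = (\<Sum>x\<in>?V \<times> S. Poly_Mapping.single (last (?f x)) 1)"
      unfolding union by (subst sum.reindex) (auto simp: inj_on_def)
    also have "\<dots> = (\<Sum>(v, s)\<in>?V \<times> S. Poly_Mapping.single (last v) 1 * Poly_Mapping.single s 1)"
      by (intro sum.cong) (auto simp: mult_single)
    also have "\<dots> = fps_nth ?a m * step_sum S"
      by (simp add: nth step_sum_def sum_product sum.cartesian_product)
    finally have "fps_nth ?a n - fps_nth ?a m * step_sum S = - fps_nth ?h n"
      by (simp add: algebra_simps eq_neg_iff_add_eq_0)
    moreover have "fps_nth (?a * (1 - fps_X * fps_const (step_sum S))) n = fps_nth ?a n - fps_nth ?a m * step_sum S"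
    proof -
      have "?a * (1 - fps_X * fps_const (step_sum S)) = ?a - fps_X * (?a * fps_const (step_sum S))"
        by (simp only: algebra_simps mult_1)
      then show ?thesis using Suc by simp
    qed
    ultimately show ?thesis using Suc by simp
  qed
  then show ?thesis by (simp add: fps_eq_iff)
qed

text \<open>The bound on heights enters here: it splits the steps into the rows -1, 0 and 1, one for
  each term of the kernel.\<close>

lemma walk_kernel_eq:
  assumes "finite S" "\<forall>(i, j)\<in>S. \<bar>j\<bar> \<le> 1"
  shows "walk_kernel S = 1 - fps_X * fps_const (step_sum S)"
proof -
  have row: "Defs.mon 0 j * step_poly S j = (\<Sum>s\<in>{s \<in> S. snd s = j}. Poly_Mapping.single s 1)" for j
  proof -
    have "Defs.mon 0 j * step_poly S j = (\<Sum>i\<in>{i. (i, j) \<in> S}. Poly_Mapping.single (i, j) 1)"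
      by (simp add: step_poly_def sum_distrib_left Defs.mon_def mult_single)
    also have "\<dots> = (\<Sum>s\<in>{s \<in> S. snd s = j}. Poly_Mapping.single s 1)"
      by (rule sum.reindex_bij_witness[of _ fst "\<lambda>i. (i, j)"]) auto
    finally show ?thesis .
  qed
  have "step_sum S = (\<Sum>j\<in>{-1, 0, 1}. \<Sum>s\<in>{s \<in> S. snd s = j}. Poly_Mapping.single s 1)"
    unfolding step_sum_def using assms by (intro sum.group[symmetric]) (auto simp: abs_le_iff)
  also have "\<dots> = Defs.mon 0 (-1) * step_poly S (-1) + Defs.mon 0 0 * step_poly S 0 + Defs.mon 0 1 * step_poly S 1"
    by (simp add: row add_ac)
  also have "Defs.mon 0 0 = 1" by (simp add: Defs.mon_def zero_prod_def[symmetric])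
  finally show ?thesis
    by (simp add: walk_kernel_def algebra_simps fps_const_add[symmetric] del: fps_const_add)
qed

section \<open>Bilateral walks\<close>

abbreviation x_axis :: "(int \<times> int) set" where "x_axis \<equiv> UNIV \<times> {0}"
abbreviation nonneg_axis :: "(int \<times> int) set" where "nonneg_axis \<equiv> {0..} \<times> {0}"
abbreviation nonpos_axis :: "(int \<times> int) set" where "nonpos_axis \<equiv> {..0} \<times> {0}"

lemma support_in_one_axis:
  "1 \<in> support_in x_axis" "1 \<in> support_in nonneg_axis" "1 \<in> support_in nonpos_axis" "1 \<in> support_in {0}"
  by (auto intro!: support_in_one simp: zero_prod_def)

text \<open>
  The series \<open>u\<close> with \<open>u = 1 + t p u + t^2 q u^2\<close>. For \<open>p = A_0\<close> and \<open>q = A_{-1} A_1\<close> it factors the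
  kernel in \<open>y\<close>: \<open>u K = (1 - t A_{-1} u / y) (1 - t A_1 u y)\<close>.
\<close>

fun motzkin_coeff :: "'a::comm_ring_1 \<Rightarrow> 'a \<Rightarrow> nat \<Rightarrow> 'a" where
  "motzkin_coeff p q 0 = 1"
| "motzkin_coeff p q (Suc 0) = p"
| "motzkin_coeff p q (Suc (Suc n)) = p * motzkin_coeff p q (Suc n) +
     q * (\<Sum>i\<le>n. motzkin_coeff p q i * motzkin_coeff p q (n - i))"

lemma motzkin_series_eq:
  fixes p q :: "'a::comm_ring_1"
  defines "u \<equiv> Abs_fps (motzkin_coeff p q)"
  shows "u = 1 + fps_X * fps_const p * u + fps_X ^ 2 * fps_const q * u ^ 2"
proof (rule fps_ext)
  fix n
  have "fps_nth (u ^ 2) m = (\<Sum>i\<le>m. motzkin_coeff p q i * motzkin_coeff p q (m - i))" for m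
    by (simp add: power2_eq_square fps_mult_nth u_def atLeast0AtMost)
  then have X2: "fps_nth (fps_X ^ 2 * (fps_const q * u ^ 2)) (Suc (Suc m)) =
      q * (\<Sum>i\<le>m. motzkin_coeff p q i * motzkin_coeff p q (m - i))" for m
    by (simp add: fps_X_power_mult_nth)
  consider "n = 0" | "n = Suc 0" | m where "n = Suc (Suc m)"
    by (metis not0_implies_Suc)
  then show "fps_nth u n = fps_nth (1 + fps_X * fps_const p * u + fps_X ^ 2 * fps_const q * u ^ 2) n"
    by cases (simp_all add: mult.assoc X2, simp_all add: u_def fps_X_power_mult_nth)
qed

lemma keys_motzkin_coeff:
  fixes p q :: laurent
  assumes "Poly_Mapping.keys p \<subseteq> x_axis" "Poly_Mapping.keys q \<subseteq> x_axis"
  shows "Poly_Mapping.keys (motzkin_coeff p q n) \<subseteq> x_axis"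
proof -
  define A :: "laurent set" where "A = {p. Poly_Mapping.keys p \<subseteq> x_axis}"
  interpret subring_of A
  proof
    show "1 \<in> A" by (auto simp: A_def zero_prod_def)
    show "a + b \<in> A" if "a \<in> A" "b \<in> A" for a b
      using that keys_add[of a b] by (auto simp: A_def)
    show "a * b \<in> A" if "a \<in> A" "b \<in> A" for a b
      using that keys_mult[of a b] unfolding A_def by fastforce
    show "- a \<in> A" if "a \<in> A" for a
      using that by (auto simp: A_def in_keys_iff subset_iff)
  qed
  have "p \<in> A" "q \<in> A" using assms by (auto simp: A_def)
  then have "motzkin_coeff p q n \<in> A"
    by (induction p q n rule: motzkin_coeff.induct)
      (auto intro!: one_closed add_closed mult_closed sum_closed)
  then show ?thesis by (simp add: A_def)
qed

lemma keys_step_poly: "Poly_Mapping.keys (step_poly S j) \<subseteq> x_axis"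
proof
  fix k assume "k \<in> Poly_Mapping.keys (step_poly S j)"
  then have "Poly_Mapping.lookup (step_poly S j) k \<noteq> 0" by (simp add: in_keys_iff)
  then obtain i where "Poly_Mapping.lookup (Defs.mon i 0) k \<noteq> 0"
    unfolding step_poly_def lookup_sum by (meson sum.not_neutral_contains_not_neutral)
  then show "k \<in> x_axis" by (auto simp: Defs.mon_def lookup_single when_def split: if_splits)
qed

text \<open>In \<open>1/(1 - R) = 1 + R/(1 - R)\<close> the last term has all exponents in
  \<open>N\<close>, hence none in \<open>M\<close>. It is applied to exponents strictly on one side
  of the axis.\<close>

lemma proj_recip_one_sided:
  assumes "R \<in> support_in N" "fps_nth R 0 = 0"
    and "N \<inter> M = {}" "0 \<in> M" "\<And>a b. a \<in> N \<Longrightarrow> b \<in> N \<Longrightarrow> a + b \<in> N"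
  shows "proj M (recip (1 - R)) = 1"
proof -
  define P where "P = recip (1 - R)"
  have P: "(1 - R) * P = 1" using recip[of "1 - R"] assms(2) by (simp add: P_def)
  have "P \<in> support_in (insert 0 N)"
    unfolding P_def
  proof (rule recip_support_in)
    show "1 - R \<in> support_in (insert 0 N)"
      using support_in_mono[OF assms(1)] by (intro support_in_diff support_in_one) auto
    show "a + b \<in> insert 0 N" if "a \<in> insert 0 N" "b \<in> insert 0 N" for a b
      using that assms(5)[of a b] by auto
  qed (use assms(2) in auto)
  then have "R * P \<in> support_in N"
  proof (rule support_in_mult[OF assms(1)])
    show "a + b \<in> N" if "a \<in> N" "b \<in> insert 0 N" for a b using that assms(5)[of a b] by auto
  qed
  then have "proj M (R * P) = 0" using assms(3) by (rule proj_eq_0)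
  moreover have "proj M 1 = 1" using assms(4) by (intro proj_id support_in_one)
  moreover have "P = 1 + R * P" using P by (simp add: algebra_simps)
  ultimately show ?thesis unfolding P_def[symmetric] by (metis proj_add add.right_neutral)
qed

text \<open>\<open>1/K = u P Q\<close>, where \<open>P\<close> has no positive and \<open>Q\<close>
  no negative powers of \<open>y\<close>. The \<open>y^0\<close> term of \<open>P Q\<close> is
  \<open>1/(1 - \<alpha>\<beta>)\<close>, and \<open>(1 - \<alpha>\<beta>)/u\<close> squares to the
  discriminant \<open>Delta S\<close>.\<close>

lemma bilateral_square_Delta:
  "proj x_axis (recip (walk_kernel S)) ^ 2 * Delta S = 1"
proof -
  define a where "a = step_poly S (-1)"
  define b where "b = step_poly S 0"
  define c where "c = step_poly S 1"
  have keys: "Poly_Mapping.keys a \<subseteq> x_axis" "Poly_Mapping.keys b \<subseteq> x_axis" "Poly_Mapping.keys c \<subseteq> x_axis"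
    unfolding a_def b_def c_def by (rule keys_step_poly)+
  define u where "u = Abs_fps (motzkin_coeff b (a * c))"
  have u_eq: "u = 1 + fps_X * fps_const b * u + fps_X ^ 2 * fps_const (a * c) * u ^ 2"
    unfolding u_def by (rule motzkin_series_eq)
  have u0: "fps_nth u 0 = 1" by (simp add: u_def)
  interpret XA: subdomain_of "support_in x_axis"
    by (rule subdomain_of_support_in) (auto simp: zero_prod_def)
  have "Poly_Mapping.keys (a * c) \<subseteq> x_axis" using keys_mult[of a c] keys by fastforce
  then have u_supp: "u \<in> support_in x_axis"
    using keys_motzkin_coeff[OF keys(2), of "a * c"] by (auto simp: support_in_def u_def)
  have X_supp: "fps_X \<in> support_in x_axis" by (rule support_in_X) (auto simp: zero_prod_def)
  define \<alpha> where "\<alpha> = fps_X * fps_const a * u"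
  define \<beta> where "\<beta> = fps_X * fps_const c * u"
  have \<alpha>\<beta>: "\<alpha> \<in> support_in x_axis" "\<beta> \<in> support_in x_axis"
    unfolding \<alpha>_def \<beta>_def using keys u_supp X_supp
    by (intro XA.mult_closed; simp add: support_in_const)+
  define Y where "Y = fps_const (Defs.mon 0 1)"
  define Y' where "Y' = fps_const (Defs.mon 0 (-1))"
  have YY': "Y * Y' = 1"
    by (simp add: Y_def Y'_def Defs.mon_def mult_single zero_prod_def[symmetric])
  have \<alpha>\<beta>_eq: "\<alpha> * \<beta> = fps_X ^ 2 * fps_const (a * c) * u ^ 2"
    by (simp add: \<alpha>_def \<beta>_def power2_eq_square mult_ac fps_const_mult[symmetric] del: fps_const_mult)
  define P where "P = recip (1 - \<alpha> * Y')"
  define Q where "Q = recip (1 - \<beta> * Y)"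
  have P: "(1 - \<alpha> * Y') * P = 1" and Q: "(1 - \<beta> * Y) * Q = 1"
    unfolding P_def Q_def by (rule recip, simp add: \<alpha>_def \<beta>_def)+
  have u_key: "u - fps_X * fps_const b * u = 1 + \<alpha> * \<beta>"
    unfolding \<alpha>\<beta>_eq by (subst (1) u_eq) (simp add: algebra_simps)
  have factor: "u * walk_kernel S = (1 - \<alpha> * Y') * (1 - \<beta> * Y)"
  proof -
    have "u * walk_kernel S = (u - fps_X * fps_const b * u) - \<alpha> * Y' - \<beta> * Y"
      by (simp add: walk_kernel_def a_def[symmetric] b_def[symmetric] c_def[symmetric] \<alpha>_def \<beta>_def
          Y_def Y'_def algebra_simps fps_const_mult[symmetric] del: fps_const_mult)
    also note u_key
    also have "1 + \<alpha> * \<beta> - \<alpha> * Y' - \<beta> * Y = 1 + (Y * Y') * \<alpha> * \<beta> - \<alpha> * Y' - \<beta> * Y"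
      by (simp add: YY')
    also have "\<dots> = (1 - \<alpha> * Y') * (1 - \<beta> * Y)" by (simp add: algebra_simps)
    finally show ?thesis .
  qed
  have W: "recip (walk_kernel S) = P * Q * u"
  proof (rule recip_unique)
    show "fps_nth (walk_kernel S) 0 = 1" by (simp add: walk_kernel_def)
    have "walk_kernel S * (P * Q * u) = (u * walk_kernel S) * (P * Q)" by (simp only: mult_ac)
    also have "\<dots> = ((1 - \<alpha> * Y') * P) * ((1 - \<beta> * Y) * Q)" unfolding factor by (simp only: mult_ac)
    finally show "walk_kernel S * (P * Q * u) = 1" by (simp add: P Q)
  qed
  \<comment> \<open>Partial fractions: with \<open>1/P = 1 - \<alpha>/y\<close> and
    \<open>1/Q = 1 - \<beta>y\<close>, this is
    \<open>1/P + 1/Q - 1/(P Q) = 1 - \<alpha>\<beta>\<close> multiplied by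
    \<open>P Q\<close>.\<close>
  have "P * Q * (1 - \<alpha> * \<beta>) = P * Q * (1 - (Y * Y') * \<alpha> * \<beta>)" by (simp add: YY')
  also have "\<dots> = ((1 - \<alpha> * Y') * P) * Q + \<alpha> * Y' * P * ((1 - \<beta> * Y) * Q)"
    by (simp add: algebra_simps)
  also have "\<alpha> * Y' * P = P - (1 - \<alpha> * Y') * P" by (simp add: algebra_simps)
  also have "(1 - \<alpha> * Y') * P * Q + (P - (1 - \<alpha> * Y') * P) * ((1 - \<beta> * Y) * Q) = P + Q - 1"
    unfolding P Q by simp
  finally have PQ: "P * Q * (1 - \<alpha> * \<beta>) = P + Q - 1" .
  have "proj x_axis P = 1"
    unfolding P_def
  proof (rule proj_recip_one_sided[where N="UNIV \<times> {..<0}"])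
    show "\<alpha> * Y' \<in> support_in (UNIV \<times> {..<0})"
      by (rule support_in_mult[OF \<alpha>\<beta>(1), of _ "{(0, -1)}"]) (auto simp: Y'_def support_in_const Defs.mon_def)
  qed (auto simp: \<alpha>_def zero_prod_def)
  moreover have "proj x_axis Q = 1"
    unfolding Q_def
  proof (rule proj_recip_one_sided[where N="UNIV \<times> {0<..}"])
    show "\<beta> * Y \<in> support_in (UNIV \<times> {0<..})"
      by (rule support_in_mult[OF \<alpha>\<beta>(2), of _ "{(0, 1)}"]) (auto simp: Y_def support_in_const Defs.mon_def)
  qed (auto simp: \<beta>_def zero_prod_def)
  moreover have "proj x_axis (P * Q * (1 - \<alpha> * \<beta>)) = proj x_axis (P * Q) * (1 - \<alpha> * \<beta>)"
    using \<alpha>\<beta> by (intro proj_mult_right[where N=x_axis] XA.diff_closed XA.mult_closed XA.one_closed) auto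
  ultimately have "proj x_axis (P * Q) * (1 - \<alpha> * \<beta>) = 1"
    unfolding PQ by (simp add: proj_add proj_diff proj_id[OF support_in_one_axis(1)])
  moreover define B where "B = proj x_axis (recip (walk_kernel S))"
  have "B = proj x_axis (P * Q) * u"
    unfolding B_def W using u_supp by (intro proj_mult_right[where N=x_axis]) auto
  ultimately have B: "B * (1 - \<alpha> * \<beta>) = u" by (simp add: mult_ac)
  \<comment> \<open>Together with the formula for \<open>\<alpha> * \<beta>\<close> this makes
    \<open>Delta S * u ^ 2\<close> a perfect square.\<close>
  have "(1 - fps_X * fps_const b) * u = 1 + \<alpha> * \<beta>"
    unfolding u_key[symmetric] by (simp only: left_diff_distrib mult_1)
  then have "Delta S * u ^ 2 = (1 + \<alpha> * \<beta>) ^ 2 - 4 * (\<alpha> * \<beta>)"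
    unfolding \<alpha>\<beta>_eq Delta_def a_def[symmetric] b_def[symmetric] c_def[symmetric]
    by (simp add: left_diff_distrib power_mult_distrib[symmetric])
  also have "\<dots> = (1 - \<alpha> * \<beta>) ^ 2" by (simp add: power2_eq_square algebra_simps)
  finally have "(B ^ 2 * Delta S) * u ^ 2 = (B * (1 - \<alpha> * \<beta>)) ^ 2"
    by (simp add: power_mult_distrib mult.assoc)
  then have "(B ^ 2 * Delta S) * u ^ 2 = 1 * u ^ 2" unfolding B by simp
  moreover have "u \<noteq> 0" using u0 by auto
  ultimately show ?thesis unfolding B_def by simp
qed

section \<open>Canonical factorization\<close>

lemma proj_one: "proj {0} 1 = 1"
  by (rule proj_id) (rule support_in_one_axis)

lemma proj_mult_nonneg:
  "F \<in> support_in nonneg_axis \<Longrightarrow> G \<in> support_in nonneg_axis \<Longrightarrow> proj {0} (F * G) = proj {0} F * proj {0} G"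
  by (rule proj_mult) (auto simp: zero_prod_def)

lemma proj_mult_nonpos:
  "F \<in> support_in nonpos_axis \<Longrightarrow> G \<in> support_in nonpos_axis \<Longrightarrow> proj {0} (F * G) = proj {0} F * proj {0} G"
  by (rule proj_mult) (auto simp: zero_prod_def)

lemma support_in_constants: "F \<in> support_in {0} \<Longrightarrow> F \<in> support_in nonneg_axis"
  "F \<in> support_in {0} \<Longrightarrow> F \<in> support_in nonpos_axis"
  by (auto elim!: support_in_mono simp: zero_prod_def)

lemma proj_recip_nonneg:
  assumes "F \<in> support_in nonneg_axis" "fps_nth F 0 = 1" "proj {0} F = 1"
  shows "proj {0} (recip F) = 1"
proof -
  have "recip F \<in> support_in nonneg_axis"
    using assms by (intro recip_support_in) (auto simp: zero_prod_def)
  then have "proj {0} (F * recip F) = proj {0} (recip F)"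
    using assms by (simp add: proj_mult_nonneg)
  then show ?thesis using recip[OF assms(2)] by (simp add: proj_one)
qed

lemma support_in_both_axes:
  "F \<in> support_in nonneg_axis \<Longrightarrow> F \<in> support_in nonpos_axis \<Longrightarrow> F \<in> support_in {0}"
  by (drule (1) support_in_Int, erule support_in_mono) (auto simp: zero_prod_def)

text \<open>Setting \<open>x\<close> or \<open>1/x\<close> to 0 amounts to \<open>proj {0}\<close>,
  whose multiplicativity on one-sided series becomes available for the normalization.\<close>

lemma proj_eq_one_iff:
  "(\<forall>n. Poly_Mapping.lookup (fps_nth F n) (0, 0) = (if n = 0 then 1 else 0)) \<longleftrightarrow> proj {0} F = 1"
proof -
  have "proj {0} F = 1 \<longleftrightarrow>
    (\<forall>n. Poly_Mapping.lookup (fps_nth F n) 0 = (if n = 0 then 1 else (0::real)))" (is "?L \<longleftrightarrow> ?R")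
  proof
    assume ?L
    then have "Poly_Mapping.lookup (fps_nth (proj {0} F) n) 0 = Poly_Mapping.lookup (fps_nth (1 :: laurent fps) n) 0" for n
      by simp
    from this[unfolded lookup_proj] have "Poly_Mapping.lookup (fps_nth F n) 0 = (if n = 0 then 1 else 0)" for n
      by (cases "n = 0") simp_all
    then show ?R by blast
  next
    assume ?R
    then show ?L by (intro laurent_fps_eqI) (auto simp: lookup_proj lookup_one when_def)
  qed
  then show ?thesis by (simp add: zero_prod_def)
qed

lemma is_canonical_factorization_iff:
  "is_canonical_factorization D D0 Dp Dm \<longleftrightarrow>
     D = D0 * Dp * Dm \<and> D0 \<in> support_in {0} \<and> Dp \<in> support_in nonneg_axis \<and> Dm \<in> support_in nonpos_axis \<and>
     fps_nth D0 0 = 1 \<and> fps_nth Dp 0 = 1 \<and> fps_nth Dm 0 = 1 \<and> proj {0} Dp = 1 \<and> proj {0} Dm = 1"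
  unfolding is_canonical_factorization_def proj_eq_one_iff
  by (simp add: support_in_def const_ring_def poly_x_def poly_xbar_def zero_prod_def)

text \<open>For two factorizations consider \<open>r = Ep/Dp = D0 Dm/(E0 Em)\<close>. The first form
  has no negative powers of \<open>x\<close>, the second no positive ones, so \<open>r\<close> is
  constant in \<open>x\<close>, and the normalization at 0 makes it 1.\<close>

lemma canonical_factorization_eqI:
  assumes "is_canonical_factorization D D0 Dp Dm"
  shows "canonical_factorization D = (D0, Dp, Dm)"
  unfolding canonical_factorization_def
proof (rule the_equality)
  show "case (D0, Dp, Dm) of (D0, Dp, Dm) \<Rightarrow> is_canonical_factorization D D0 Dp Dm"
    using assms by simp
next
  fix T assume T: "case T of (D0, Dp, Dm) \<Rightarrow> is_canonical_factorization D D0 Dp Dm"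
  obtain E0 Ep Em where T_eq: "T = (E0, Ep, Em)" by (cases T)
  note d = assms[unfolded is_canonical_factorization_iff]
  have e: "D = E0 * Ep * Em" "E0 \<in> support_in {0}" "Ep \<in> support_in nonneg_axis"
    "Em \<in> support_in nonpos_axis" "fps_nth E0 0 = 1" "fps_nth Ep 0 = 1" "fps_nth Em 0 = 1"
    "proj {0} Ep = 1" "proj {0} Em = 1"
    using T by (auto simp: T_eq is_canonical_factorization_iff)
  interpret P: subdomain_of "support_in nonneg_axis"
    by (rule subdomain_of_support_in) (auto simp: zero_prod_def)
  interpret N: subdomain_of "support_in nonpos_axis"
    by (rule subdomain_of_support_in) (auto simp: zero_prod_def)
  define r where "r = Ep * recip Dp"
  have "recip Dp \<in> support_in nonneg_axis"
    using d by (intro recip_support_in) (auto simp: zero_prod_def)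
  then have r_P: "r \<in> support_in nonneg_axis" unfolding r_def using e by (intro P.mult_closed)
  have r_proj: "proj {0} r = 1"
    unfolding r_def using d e \<open>recip Dp \<in> _\<close> by (simp add: proj_mult_nonneg proj_recip_nonneg)
  have "E0 * Em * r = (E0 * Ep * Em) * recip Dp" by (simp add: r_def mult_ac)
  also have "\<dots> = (D0 * Dm) * (Dp * recip Dp)" using d e by (simp add: mult_ac)
  also have "\<dots> = D0 * Dm" using d recip by simp
  finally have r_eq: "E0 * Em * r = D0 * Dm" .
  have EN: "E0 * Em \<in> support_in nonpos_axis" "D0 * Dm \<in> support_in nonpos_axis"
    using e d support_in_constants by (auto intro!: N.mult_closed)
  have "r = (E0 * Em * recip (E0 * Em)) * r" using e recip by simp
  also have "\<dots> = recip (E0 * Em) * (D0 * Dm)" using r_eq by (simp add: mult_ac)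
  also have "\<dots> \<in> support_in nonpos_axis"
    by (rule N.mult_closed[OF recip_support_in[OF EN(1)] EN(2)]) (use e in \<open>auto simp: zero_prod_def\<close>)
  finally have "r \<in> support_in {0}" using r_P support_in_both_axes by blast
  then have "r = 1" using r_proj by (simp add: proj_id)
  have "Ep = r * Dp" using d recip[of Dp] by (simp add: r_def mult_ac)
  then have p: "Ep = Dp" using \<open>r = 1\<close> by simp
  have eq: "E0 * Em = D0 * Dm" using r_eq \<open>r = 1\<close> by simp
  have "proj {0} (E0 * Em) = E0" "proj {0} (D0 * Dm) = D0"
    using d e by (simp_all add: proj_mult_nonpos support_in_constants proj_id)
  then have z: "E0 = D0" using eq by metis
  moreover have "D0 \<noteq> 0" using d by auto
  ultimately have "Em = Dm" using eq by simp
  with p z show "T = (D0, Dp, Dm)" by (simp add: T_eq)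
qed

section \<open>Walks on the slit plane\<close>

lemma walk_gf_trivial: "walk_gf {[(0, 0)]} = 1"
proof (rule fps_ext)
  fix n
  have "{w \<in> {[(0::int, 0::int)]}. length w = n + 1} = (if n = 0 then {[(0, 0)]} else {})" by auto
  then show "fps_nth (walk_gf {[(0, 0)]}) n = fps_nth 1 n"
    by (subst walk_gf_nth[of "{}"]) (auto simp: walks_def zero_prod_def[symmetric])
qed

lemma avoids_last: "avoids F w \<Longrightarrow> w \<in> walks S \<Longrightarrow> w = [(0, 0)] \<or> last w \<notin> F"
proof -
  assume w: "avoids F w" "w \<in> walks S"
  then have "w \<noteq> []" "w ! 0 = (0, 0)" by (auto simp: walks_def)
  show ?thesis
  proof (cases "length w = 1")
    case True
    then show ?thesis using \<open>w ! 0 = (0, 0)\<close> by (auto simp: length_Suc_conv)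
  next
    case False
    then have "1 \<le> length w - 1" "length w - 1 < length w"
      using length_greater_0_conv[of w] \<open>w \<noteq> []\<close> by linarith+
    then have "w ! (length w - 1) \<notin> F" using w(1) unfolding avoids_def by blast
    then show ?thesis using \<open>w \<noteq> []\<close> by (simp add: last_conv_nth)
  qed
qed

lemma trivial_walk: "[(0, 0)] \<in> walks S" "avoids F [(0, 0)]"
  by (auto simp: walks_def avoids_def)

text \<open>
  Dividing the first passage equation of the half-lines \<open>i \<le> 0\<close> and \<open>i < 0\<close> by one another gives a
  series that involves neither positive nor negative powers of \<open>x\<close>; it counts the loops.
\<close>

lemma slit_plane_series:
  fixes S :: "(int \<times> int) set"
  assumes "finite S" "\<forall>(i, j)\<in>S. \<bar>j\<bar> \<le> 1"
  defines "B \<equiv> walk_gf {w \<in> walks S. bilateral w}"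
    and "W \<equiv> walk_gf {w \<in> walks S. on_slit_plane w}"
    and "S0 \<equiv> walk_gf {w \<in> walks S. on_slit_plane w \<and> bilateral w}"
    and "L \<equiv> walk_gf {w \<in> walks S. is_loop w}"
  obtains G h where
    "B ^ 2 * Delta S = 1" "fps_nth B 0 = 1" "W = G * recip (walk_kernel S)"
    "fps_nth G 0 = 1" "fps_nth S0 0 = 1" "fps_nth h 0 = 1" "h * L = 1"
    "is_canonical_factorization (Delta S) (h ^ 2) (recip S0 ^ 2) ((G * L) ^ 2)"
proof -
  define K where "K = walk_kernel S"
  have K: "K = 1 - fps_X * fps_const (step_sum S)"
    unfolding K_def using assms(1,2) by (rule walk_kernel_eq)
  have K0: "fps_nth K 0 = 1" by (simp add: K)
  have quot: "walk_gf {w \<in> walks S. avoids F w} = (1 - walk_gf {w \<in> walks S. first_hits F w}) * recip K" for F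
  proof -
    have "walk_gf {w \<in> walks S. avoids F w} = walk_gf {w \<in> walks S. avoids F w} * K * recip K"
      using recip[OF K0] by (simp add: mult.assoc)
    then show ?thesis unfolding K walk_gf_first_passage[OF assms(1)] .
  qed
  have hits0: "fps_nth (walk_gf {w \<in> walks S. first_hits F w}) 0 = 0" for F
    using assms(1) by (subst walk_gf_nth[of S]) (auto simp: first_hits_def intro!: sum.neutral)
  have proj_bil: "proj x_axis (walk_gf {w \<in> walks S. P w}) = walk_gf {w \<in> walks S. P w \<and> bilateral w}" for P
  proof -
    have "{w \<in> {w \<in> walks S. P w}. last w \<in> x_axis} = {w \<in> walks S. P w \<and> bilateral w}"
      by (auto simp: bilateral_def mem_Times_iff)
    then show ?thesis using assms(1) by (simp add: proj_walk_gf)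
  qed
  \<comment> \<open>For \<open>F = {}\<close> every walk avoids and none hits, so the first passage
    identity says that \<open>recip K\<close> counts all walks.\<close>
  have "{w \<in> walks S. avoids {} w} = walks S" "{w \<in> walks S. first_hits {} w} = {}"
    by (auto simp: avoids_def first_hits_def)
  moreover have "walk_gf {} = 0" by (simp add: walk_gf_def fps_eq_iff)
  ultimately have "walk_gf (walks S) = recip K" using quot[of "{}"] by (simp only: diff_zero mult_1)
  then have B: "B = proj x_axis (recip K)"
    using proj_bil[of "\<lambda>_. True"] by (simp add: B_def)
  have B2: "B ^ 2 * Delta S = 1" unfolding B K_def by (rule bilateral_square_Delta)
  \<comment> \<open>First hits of a subset of the axis end on the axis, so their series is free of
    \<open>y\<close> and can be pulled out of the extraction of \<open>y^0\<close>.\<close>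
  have bil: "walk_gf {w \<in> walks S. avoids F w \<and> bilateral w} = B * (1 - walk_gf {w \<in> walks S. first_hits F w})"
    if F: "F \<subseteq> x_axis" for F
  proof -
    have "walk_gf {w \<in> walks S. first_hits F w} \<in> support_in x_axis"
      using F assms(1) by (intro walk_gf_support_in[of S]) (auto simp: first_hits_def)
    then have "1 - walk_gf {w \<in> walks S. first_hits F w} \<in> support_in x_axis"
      by (intro support_in_diff support_in_one_axis)
    then show ?thesis
      unfolding proj_bil[symmetric] quot[of F] B mult.commute[of _ "recip K"]
      by (rule proj_mult_right) auto
  qed
  \<comment> \<open>\<open>H\<close> is the slit; \<open>H'\<close> leaves out the origin, where
    loops end. Thus only the trivial walk avoids \<open>H\<close> and ends at the origin, whereas
    avoiding \<open>H'\<close> and ending there characterizes loops.\<close>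
  define H where "H = {(i, 0::int) | i :: int. i \<le> 0}"
  define H' where "H' = {(i, 0::int) | i :: int. i < 0}"
  define G where "G = 1 - walk_gf {w \<in> walks S. first_hits H w}"
  define N where "N = walk_gf {w \<in> walks S. first_hits H' w}"
  define V where "V = walk_gf {w \<in> walks S. avoids H' w \<and> bilateral w}"
  have slit: "on_slit_plane w \<longleftrightarrow> avoids H w" for w
    by (simp add: on_slit_plane_def avoids_def H_def)
  have W_eq: "W = G * recip K" unfolding W_def slit G_def by (rule quot)
  have S0: "S0 = B * G" unfolding S0_def slit G_def by (rule bil) (auto simp: H_def)
  have V: "V = B * (1 - N)" unfolding V_def N_def by (rule bil) (auto simp: H'_def)
  have G_supp: "G \<in> support_in nonpos_axis"
    unfolding G_def using assms(1)
    by (intro support_in_diff support_in_one_axis walk_gf_support_in[of S]) (auto simp: first_hits_def H_def)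
  have N_supp: "N \<in> support_in ({..<0} \<times> {0})"
    unfolding N_def using assms(1)
    by (intro walk_gf_support_in[of S]) (auto simp: first_hits_def H'_def)
  have S0_supp: "S0 \<in> support_in nonneg_axis"
    unfolding S0_def slit
  proof (rule walk_gf_support_in[OF assms(1)])
    fix w assume w: "w \<in> {w \<in> walks S. avoids H w \<and> bilateral w}"
    then have "w = [(0, 0)] \<or> last w \<notin> H" using avoids_last by blast
    with w show "last w \<in> nonneg_axis" by (cases "last w") (auto simp: H_def bilateral_def)
  qed auto
  have V_supp: "V \<in> support_in nonneg_axis"
    unfolding V_def
  proof (rule walk_gf_support_in[OF assms(1)])
    fix w assume w: "w \<in> {w \<in> walks S. avoids H' w \<and> bilateral w}"
    then have "w = [(0, 0)] \<or> last w \<notin> H'" using avoids_last by blast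
    with w show "last w \<in> nonneg_axis" by (cases "last w") (auto simp: H'_def bilateral_def)
  qed auto
  have S0_proj: "proj {0} S0 = 1"
  proof -
    have "{w \<in> {w \<in> walks S. avoids H w \<and> bilateral w}. last w \<in> {0}} = {[(0, 0)]}" (is "?L = _")
    proof
      show "?L \<subseteq> {[(0, 0)]}"
      proof
        fix w assume w: "w \<in> ?L"
        then have "w = [(0, 0)] \<or> last w \<notin> H" using avoids_last by blast
        with w show "w \<in> {[(0, 0)]}" by (auto simp: H_def zero_prod_def)
      qed
      show "{[(0, 0)]} \<subseteq> ?L" using trivial_walk by (auto simp: bilateral_def zero_prod_def)
    qed
    then show ?thesis unfolding S0_def slit
      by (subst proj_walk_gf[OF assms(1)]) (auto simp: walk_gf_trivial)
  qed
  have V_proj: "proj {0} V = L"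
  proof -
    have "{w \<in> {w \<in> walks S. avoids H' w \<and> bilateral w}. last w \<in> {0}} = {w \<in> walks S. is_loop w}"
    proof (rule Collect_cong)
      fix w
      have "is_loop w \<longleftrightarrow> avoids H' w \<and> last w = 0" if "w \<in> walks S"
      proof -
        have "w ! 0 \<notin> H'" using that by (auto simp: walks_def H'_def)
        then have "(\<forall>k<length w. w ! k \<notin> H') \<longleftrightarrow> avoids H' w"
          unfolding avoids_def by (metis One_nat_def Suc_leI neq0_conv)
        then show ?thesis by (auto simp: is_loop_def H'_def zero_prod_def)
      qed
      then show "w \<in> {w \<in> walks S. avoids H' w \<and> bilateral w} \<and> last w \<in> {0} \<longleftrightarrow> w \<in> walks S \<and> is_loop w"
        by (auto simp: bilateral_def zero_prod_def)
    qed
    then show ?thesis unfolding V_def L_def by (subst proj_walk_gf[OF assms(1)]) auto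
  qed
  have G0: "fps_nth G 0 = 1" by (simp add: G_def hits0)
  have nth0: "fps_nth B 0 = 1"
    unfolding B proj_def by (intro poly_mapping_eqI) (auto simp: lookup_restrict_keys lookup_one when_def zero_prod_def)
  have S00: "fps_nth S0 0 = 1" by (simp add: S0 nth0 G0)
  interpret P: subdomain_of "support_in nonneg_axis"
    by (rule subdomain_of_support_in) (auto simp: zero_prod_def)
  interpret Q: subdomain_of "support_in nonpos_axis"
    by (rule subdomain_of_support_in) (auto simp: zero_prod_def)
  have rS0: "recip S0 \<in> support_in nonneg_axis"
    using S0_supp S00 by (intro recip_support_in) (auto simp: zero_prod_def)
  have rS0_proj: "proj {0} (recip S0) = 1" using S0_supp S00 S0_proj by (rule proj_recip_nonneg)
  have rG: "recip G \<in> support_in nonpos_axis"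
    using G_supp G0 by (intro recip_support_in) (auto simp: zero_prod_def)
  have N1: "1 - N \<in> support_in nonpos_axis"
    using N_supp by (intro Q.diff_closed Q.one_closed) (auto elim: support_in_mono)
  \<comment> \<open>\<open>c\<close> is also \<open>(1 - N)/G\<close>; the two forms exclude
    negative and positive powers of \<open>x\<close>. The \<open>x^0\<close> term of the first
    identifies \<open>c\<close> with \<open>L\<close>, that of \<open>c * G = 1 - N\<close> gives
    \<open>h * L = 1\<close>.\<close>
  define c where "c = V * recip S0"
  have c_S0: "c * S0 = V" using recip[OF S00] by (simp add: c_def mult_ac)
  have "B * (c * G) = B * (1 - N)" using c_S0 by (simp add: S0 V mult_ac)
  moreover have "B \<noteq> 0" using nth0 by auto
  ultimately have cG: "c * G = 1 - N" by simp
  have "c = (1 - N) * recip G" using recip[OF G0] by (simp add: cG[symmetric] mult.assoc)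
  then have "c \<in> support_in nonpos_axis" using N1 rG by (auto intro: Q.mult_closed)
  moreover have "c \<in> support_in nonneg_axis" unfolding c_def using V_supp rS0 by (rule P.mult_closed)
  ultimately have c_supp: "c \<in> support_in {0}" using support_in_both_axes by blast
  have "proj {0} c = L"
    unfolding c_def using V_supp rS0 by (simp add: proj_mult_nonneg V_proj rS0_proj)
  with c_supp have cL: "c = L" by (simp add: proj_id)
  define h where "h = proj {0} G"
  have "proj {0} (1 - N) = 1"
  proof -
    have "proj {0} N = 0" by (rule proj_eq_0[OF N_supp]) (simp add: zero_prod_def)
    then show ?thesis by (simp add: proj_diff proj_one)
  qed
  moreover have "proj {0} (c * G) = c * h"
    using c_supp G_supp by (simp add: proj_mult_nonpos support_in_constants proj_id h_def)
  ultimately have hL: "h * L = 1" using cG cL by (simp add: mult.commute)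
  have h0: "fps_nth h 0 = 1"
    unfolding h_def proj_def by (intro poly_mapping_eqI) (auto simp: G0 lookup_restrict_keys lookup_one when_def)
  have h_supp: "h \<in> support_in {0}"
    using proj_support[OF support_in_UNIV, of "{0}" G] by (simp add: h_def)
  have L0: "fps_nth L 0 = 1"
    using arg_cong[OF hL, of "\<lambda>F. fps_nth F 0"] h0 by simp
  have GL_supp: "G * L \<in> support_in nonpos_axis"
    using G_supp c_supp cL support_in_constants by (auto intro: Q.mult_closed)
  have GL_proj: "proj {0} (G * L) = 1"
    using G_supp c_supp hL unfolding cL
    by (simp add: proj_mult_nonpos support_in_constants proj_id h_def)
  have "Delta S * (S0 ^ 2) = (B ^ 2 * Delta S) * G ^ 2" by (simp add: S0 power_mult_distrib mult_ac)
  then have D: "Delta S * (S0 ^ 2) = G ^ 2" by (simp add: B2)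
  have "Delta S = Delta S * (S0 * recip S0) ^ 2" using recip[OF S00] by simp
  also have "\<dots> = G ^ 2 * recip S0 ^ 2" by (simp add: D[symmetric] power_mult_distrib mult_ac)
  \<comment> \<open>The inserted factor 1 splits \<open>G\<close> into its constant term
    \<open>h\<close> and the normalized series \<open>G * L\<close>.\<close>
  also have "\<dots> = (h * L) ^ 2 * (G ^ 2 * recip S0 ^ 2)" by (simp add: hL)
  also have "\<dots> = h ^ 2 * recip S0 ^ 2 * (G * L) ^ 2" by (simp add: power_mult_distrib mult_ac)
  finally have fact: "Delta S = h ^ 2 * recip S0 ^ 2 * (G * L) ^ 2" .
  have "is_canonical_factorization (Delta S) (h ^ 2) (recip S0 ^ 2) ((G * L) ^ 2)"
    unfolding is_canonical_factorization_iff
  proof (intro conjI)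
    show "h ^ 2 \<in> support_in {0}"
      unfolding power2_eq_square by (rule support_in_mult[OF h_supp h_supp]) auto
    show "recip S0 ^ 2 \<in> support_in nonneg_axis" using rS0 by (rule P.power_closed)
    show "(G * L) ^ 2 \<in> support_in nonpos_axis" using GL_supp by (rule Q.power_closed)
    show "proj {0} (recip S0 ^ 2) = 1"
      unfolding power2_eq_square using rS0 by (simp add: proj_mult_nonneg rS0_proj)
    show "proj {0} ((G * L) ^ 2) = 1"
      using proj_mult_nonpos[OF GL_supp GL_supp] by (simp add: power2_eq_square GL_proj)
  qed (use fact in \<open>simp_all add: fps_nth_power_0 h0 G0 L0\<close>)
  with B2 nth0 W_eq G0 S00 h0 hL show ?thesis
    unfolding K_def by (rule that)
qed

section \<open>Polynomials in \<open>t\<close>\<close>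

text \<open>The coefficient ring of \<open>algebraic_series\<close>, embedded among the series so
  that coefficients and algebraic elements share one domain.\<close>

definition t_polys :: "(int \<times> int) set \<Rightarrow> laurent fps set" where
  "t_polys M = range fps_of_poly \<inter> support_in M"

definition xpow :: "int \<Rightarrow> laurent fps" where
  "xpow i = fps_const (Defs.mon i 0)"

lemma subdomain_of_range_fps_of_poly: "subdomain_of (range (fps_of_poly :: laurent poly \<Rightarrow> _))"
proof
  show "1 \<in> range (fps_of_poly :: laurent poly \<Rightarrow> _)" by (rule range_eqI[of _ _ 1]) simp
qed (auto simp: fps_of_poly_add[symmetric] fps_of_poly_mult[symmetric] fps_of_poly_uminus[symmetric])

lemma fps_const_in_range_fps_of_poly: "fps_const c \<in> range fps_of_poly"
  by (metis fps_of_poly_const rangeI)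

lemma subdomain_of_t_polys:
  assumes "0 \<in> M" "\<And>a b. a \<in> M \<Longrightarrow> b \<in> M \<Longrightarrow> a + b \<in> M"
  shows "subdomain_of (t_polys M)"
proof -
  interpret A: subdomain_of "range (fps_of_poly :: laurent poly \<Rightarrow> _)"
    by (rule subdomain_of_range_fps_of_poly)
  interpret B: subdomain_of "support_in M" using assms by (rule subdomain_of_support_in)
  show ?thesis
    unfolding t_polys_def
    by unfold_locales
      (blast intro: A.one_closed B.one_closed A.add_closed B.add_closed A.mult_closed B.mult_closed
        A.uminus_closed B.uminus_closed)+
qed

lemma t_polys_mono: "M \<subseteq> N \<Longrightarrow> t_polys M \<subseteq> t_polys N"
  by (auto simp: t_polys_def elim: support_in_mono)

text \<open>\<open>fps_of_poly\<close> is injective, so the coefficients of an annihilating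
  polynomial can be read back as polynomials in \<open>t\<close>.\<close>

lemma algebraic_series_if_algebraic_over:
  assumes "algebraic_over (t_polys M) F" "R = {p. Poly_Mapping.keys p \<subseteq> M}"
  shows "algebraic_series R F"
proof -
  from assms obtain p where p: "p \<noteq> 0" "\<And>i. Polynomial.coeff p i \<in> t_polys M" "poly p F = 0"
    by (auto simp: algebraic_over_def)
  define \<kappa> :: "laurent fps \<Rightarrow> laurent poly" where "\<kappa> = inv_into UNIV fps_of_poly"
  have \<kappa>: "\<kappa> (fps_of_poly q) = q" for q
    unfolding \<kappa>_def by (rule inv_into_f_f) (auto simp: inj_on_def fps_of_poly_eq_iff)
  have \<kappa>0: "\<kappa> 0 = 0" using \<kappa>[of 0] by simp
  define P where "P = map_poly \<kappa> p"
  have coeff_P: "Polynomial.coeff P i = \<kappa> (Polynomial.coeff p i)" for i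
    unfolding P_def by (rule coeff_map_poly) (rule \<kappa>0)
  have fps_P: "fps_of_poly (Polynomial.coeff P i) = Polynomial.coeff p i" for i
    using p(2)[of i] by (auto simp: coeff_P t_polys_def \<kappa>)
  have "map_poly fps_of_poly P = p"
    by (rule poly_eqI) (simp add: coeff_map_poly fps_P)
  moreover from this have "P \<noteq> 0" using p(1) by auto
  moreover have "Polynomial.coeff (Polynomial.coeff P i) j \<in> R" for i j
  proof -
    have "Polynomial.coeff (Polynomial.coeff P i) j = fps_nth (Polynomial.coeff p i) j"
      by (simp flip: fps_P)
    then show ?thesis using p(2)[of i] by (simp add: t_polys_def support_in_def assms(2))
  qed
  ultimately show ?thesis using p(3) unfolding algebraic_series_def by (intro exI[of _ P]) simp
qed

text \<open>Provides the monomial that clears negative exponents. The bound sums all occurring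
  exponents in absolute value, which avoids a maximum over a possibly empty set.\<close>

lemma fps_of_poly_bounded_support:
  obtains m :: nat where "fps_of_poly q \<in> support_in ({- int m..int m} \<times> {- int m..int m})"
proof
  define K where "K = (\<Union>n\<le>Polynomial.degree q. Poly_Mapping.keys (Polynomial.coeff q n))"
  define s where "s = (\<Sum>k\<in>K. \<bar>fst k\<bar> + \<bar>snd k\<bar>)"
  have "finite K" by (simp add: K_def)
  have bound: "\<bar>fst k\<bar> + \<bar>snd k\<bar> \<le> s" if "k \<in> K" for k
    unfolding s_def using that \<open>finite K\<close> by (intro member_le_sum) auto
  have "k \<in> K" if "k \<in> Poly_Mapping.keys (Polynomial.coeff q n)" for k n
    using that by (cases "n \<le> Polynomial.degree q") (auto simp: K_def coeff_eq_0)
  then show "fps_of_poly q \<in> support_in ({- int (nat s)..int (nat s)} \<times> {- int (nat s)..int (nat s)})"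
    using bound by (fastforce simp: support_in_def)
qed

section \<open>Series in \<open>x\<close> as polynomials over the series in \<open>t\<close>\<close>

lemma xpow_mult: "xpow i * xpow j = xpow (i + j)"
  by (simp add: xpow_def Defs.mon_def mult_single)

lemma xpow_0: "xpow 0 = 1"
  by (simp add: xpow_def Defs.mon_def zero_prod_def[symmetric])

lemma xpow_inverse: "xpow i * xpow (- i) = 1"
  by (simp add: xpow_mult xpow_0)

lemma xpow_power: "xpow 1 ^ n = xpow (int n)"
  by (induction n) (simp_all add: xpow_mult xpow_0)

lemma keys_mon: "Poly_Mapping.keys (Defs.mon i j) = {(i, j)}"
  by (simp add: Defs.mon_def)

lemma xpow_mult_support:
  assumes "F \<in> support_in M" "\<And>a. a \<in> M \<Longrightarrow> (i, 0) + a \<in> N"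
  shows "xpow i * F \<in> support_in N"
  by (rule support_in_mult[OF _ assms(1), of _ "{(i, 0)}"]) (use assms(2) in \<open>auto simp: xpow_def support_in_const keys_mon\<close>)

lemma lookup_single_mult:
  fixes p :: laurent
  shows "Poly_Mapping.lookup (Poly_Mapping.single a 1 * p) (a + l) = Poly_Mapping.lookup p l"
proof -
  have p: "p = restrict_keys UNIV p"
    by (rule poly_mapping_eqI) (simp add: lookup_restrict_keys)
  have "Poly_Mapping.single a 1 * p =
      (\<Sum>k\<in>Poly_Mapping.keys p. Poly_Mapping.single (a + k) (Poly_Mapping.lookup p k))"
    by (subst p) (simp add: restrict_keys_def sum_distrib_left mult_single)
  then show ?thesis
    by (simp add: lookup_sum lookup_single when_def sum.delta in_keys_iff)
qed

text \<open>The coefficient of \<open>x^i y^0\<close> is a series in \<open>t\<close>; placing it at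
  exponent 0 keeps it in the same ring.\<close>

definition xcoeff :: "int \<Rightarrow> laurent fps \<Rightarrow> laurent fps" where
  "xcoeff i F = Abs_fps (\<lambda>n. Poly_Mapping.single 0 (Poly_Mapping.lookup (fps_nth F n) (i, 0)))"

lemma xcoeff_support: "xcoeff i F \<in> support_in {0}"
  by (auto simp: support_in_def xcoeff_def split: if_splits)

lemma xcoeff_0: "xcoeff 0 F = proj {0} F"
  by (rule laurent_fps_eqI) (auto simp: xcoeff_def lookup_proj lookup_single when_def zero_prod_def)

lemma xcoeff_xpow: "xcoeff i (xpow i * F) = xcoeff 0 F"
  using lookup_single_mult[of "(i, 0)" _ "0"]
  by (simp add: xcoeff_def xpow_def Defs.mon_def zero_prod_def)

lemma xcoeff_t_polys: "F \<in> range fps_of_poly \<Longrightarrow> xcoeff i F \<in> t_polys {0}"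
proof -
  assume "F \<in> range fps_of_poly"
  then obtain q where q: "F = fps_of_poly q" by auto
  define f where "f p = Poly_Mapping.single (0 :: int \<times> int) (Poly_Mapping.lookup p (i, 0 :: int) :: real)" for p
  have "xcoeff i F = fps_of_poly (map_poly f q)"
    by (rule fps_ext) (simp add: xcoeff_def q f_def coeff_map_poly)
  then show ?thesis using xcoeff_support[of i F] by (simp add: t_polys_def)
qed

text \<open>Makes \<open>x\<close> an indeterminate over the series in \<open>t\<close>, so that one
  can speak of roots; evaluation at \<open>xpow 1\<close> undoes this.\<close>

definition poly_of_series :: "nat \<Rightarrow> laurent fps \<Rightarrow> laurent fps poly" where
  "poly_of_series d F = (\<Sum>i\<le>d. Polynomial.monom (xcoeff (int i) F) i)"

lemma coeff_poly_of_series: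
  "Polynomial.coeff (poly_of_series d F) i = (if i \<le> d then xcoeff (int i) F else 0)"
  by (simp add: poly_of_series_def coeff_sum)

lemma poly_of_series:
  assumes "F \<in> support_in ({0..int d} \<times> {0})"
  shows "poly (poly_of_series d F) (xpow 1) = F"
proof (rule laurent_fps_eqI)
  fix n and k :: "int \<times> int"
  have "poly (poly_of_series d F) (xpow 1) = (\<Sum>i\<le>d. xcoeff (int i) F * xpow (int i))"
    by (simp add: poly_of_series_def poly_sum poly_monom xpow_power)
  then have "fps_nth (poly (poly_of_series d F) (xpow 1)) n =
      (\<Sum>i\<le>d. Poly_Mapping.single (int i, 0) (Poly_Mapping.lookup (fps_nth F n) (int i, 0)))"
    by (simp add: fps_sum_nth xcoeff_def xpow_def Defs.mon_def mult_single)
  then have eq: "Poly_Mapping.lookup (fps_nth (poly (poly_of_series d F) (xpow 1)) n) k =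
      (\<Sum>i\<le>d. if (int i, 0) = k then Poly_Mapping.lookup (fps_nth F n) k else 0)"
    by (simp add: lookup_sum lookup_single when_def) (auto intro!: sum.cong)
  show "Poly_Mapping.lookup (fps_nth (poly (poly_of_series d F) (xpow 1)) n) k =
      Poly_Mapping.lookup (fps_nth F n) k"
  proof (cases "k \<in> {0..int d} \<times> {0}")
    case True
    then obtain j where j: "k = (int j, 0)" "j \<le> d"
      by (metis SigmaE atLeastAtMost_iff singletonD nonneg_int_cases of_nat_le_iff)
    then show ?thesis unfolding eq by (simp add: sum.delta)
  next
    case False
    then show ?thesis unfolding eq using support_inD[OF assms] by (auto intro!: sum.neutral)
  qed
qed

text \<open>\<open>x\<close> is transcendental over the series in \<open>t\<close>, so the value at
  \<open>x\<close> determines the polynomial.\<close>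

lemma coeff_eq_xcoeff_poly:
  assumes "\<And>i. Polynomial.coeff p i \<in> support_in {0}"
  shows "Polynomial.coeff p j = xcoeff (int j) (poly p (xpow 1))"
proof (rule fps_ext)
  fix n
  define c where "c i = Poly_Mapping.lookup (fps_nth (Polynomial.coeff p i) n) 0" for i
  have single: "fps_nth (Polynomial.coeff p i) n = Poly_Mapping.single 0 (c i)" for i
  proof (rule poly_mapping_eqI)
    fix k
    show "Poly_Mapping.lookup (fps_nth (Polynomial.coeff p i) n) k =
        Poly_Mapping.lookup (Poly_Mapping.single 0 (c i)) k"
      using support_inD[OF assms[of i], of k n]
      by (cases "k = 0") (simp_all add: c_def lookup_single when_def)
  qed
  have "poly p (xpow 1) = (\<Sum>i\<le>Polynomial.degree p. Polynomial.coeff p i * xpow (int i))"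
    by (simp add: poly_altdef xpow_power)
  then have "fps_nth (poly p (xpow 1)) n = (\<Sum>i\<le>Polynomial.degree p. Poly_Mapping.single (int i, 0) (c i))"
    by (simp add: fps_sum_nth single xpow_def Defs.mon_def mult_single)
  then have "Poly_Mapping.lookup (fps_nth (poly p (xpow 1)) n) (int j, 0) =
      (\<Sum>i\<le>Polynomial.degree p. if i = j then c i else 0)"
    by (simp add: lookup_sum lookup_single when_def)
  also have "\<dots> = c j"
    by (auto simp: sum.delta c_def coeff_eq_0)
  finally show "fps_nth (Polynomial.coeff p j) n = fps_nth (xcoeff (int j) (poly p (xpow 1))) n"
    by (simp add: single xcoeff_def)
qed

section \<open>Algebraicity of the canonical factors\<close>

text \<open>
  The factors are polynomials in \<open>x\<close> and in \<open>1/x\<close> respectively, so that up to a power of \<open>x\<close> the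
  factorization is one of polynomials in \<open>x\<close> over the series in \<open>t\<close>; the roots of the left-hand side are
  algebraic over \<open>\<real>[t]\<close>.
\<close>

lemma canonical_factors_algebraic:
  assumes "is_canonical_factorization D D0 Dp Dm" "D \<in> range fps_of_poly"
  shows "algebraic_over (t_polys {0}) D0"
    and "algebraic_over (t_polys nonneg_axis) Dp"
    and "algebraic_over (t_polys nonneg_axis) Dm"
proof -
  note d = assms(1)[unfolded is_canonical_factorization_iff]
  interpret P: subdomain_of "support_in nonneg_axis"
    by (rule subdomain_of_support_in) (auto simp: zero_prod_def)
  interpret N: subdomain_of "support_in nonpos_axis"
    by (rule subdomain_of_support_in) (auto simp: zero_prod_def)
  interpret Z: subdomain_of "support_in {0}" by (rule subdomain_of_support_in) auto
  interpret A0: subdomain_of "t_polys {0}" by (rule subdomain_of_t_polys) auto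
  interpret A1: subdomain_of "t_polys nonneg_axis"
    by (rule subdomain_of_t_polys) (auto simp: zero_prod_def)
  interpret alg1: subdomain_of "{b. algebraic_over (t_polys nonneg_axis) b}"
    by (rule A1.subdomain_of_algebraics)
  interpret R: subdomain_of "range (fps_of_poly :: laurent poly \<Rightarrow> _)"
    by (rule subdomain_of_range_fps_of_poly)
  obtain m where m: "D \<in> support_in ({- int m..int m} \<times> {- int m..int m})"
    using assms(2) fps_of_poly_bounded_support by (metis imageE)
  \<comment> \<open>\<open>D0\<close> is free of \<open>x\<close> and joins \<open>Dp\<close>, which
    leaves the two-term factorization \<open>x^m D = U w\<close>.\<close>
  define U where "U = D0 * Dp"
  define w where "w = xpow (int m) * Dm"
  have D: "D = U * Dm" using d by (simp add: U_def)
  have U0: "fps_nth U 0 = 1" using d by (simp add: U_def)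
  have U_P: "U \<in> support_in nonneg_axis"
    unfolding U_def using d support_in_constants by (intro P.mult_closed) auto
  have rU: "recip U \<in> support_in nonneg_axis"
    using U_P U0 by (intro recip_support_in) (auto simp: zero_prod_def)
  have rDm: "recip Dm \<in> support_in nonpos_axis"
    using d by (intro recip_support_in) (auto simp: zero_prod_def)
  have Dx: "D \<in> support_in x_axis"
    unfolding D by (rule support_in_mult[OF U_P, of _ nonpos_axis]) (use d in auto)
  have D_m: "D \<in> support_in ({- int m..int m} \<times> {0})"
    by (rule support_in_mono[OF support_in_Int[OF m Dx]]) auto
  \<comment> \<open>Exponents of \<open>w\<close> are at most \<open>m\<close> because of
    \<open>Dm\<close>, and nonnegative because \<open>w = x^m D / U\<close>. So \<open>w\<close> is
    a polynomial in \<open>x\<close>; the mirrored argument with \<open>U = D / Dm\<close> treats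
    \<open>U\<close>.\<close>
  have "w \<in> support_in ({..int m} \<times> {0})"
    unfolding w_def by (rule xpow_mult_support[where M=nonpos_axis]) (use d in auto)
  moreover have "w \<in> support_in nonneg_axis"
  proof -
    have "xpow (int m) * D \<in> support_in nonneg_axis"
      by (rule xpow_mult_support[OF D_m]) auto
    moreover have "w = (xpow (int m) * D) * recip U"
      using recip[OF U0] by (simp add: w_def D mult_ac)
    ultimately show ?thesis using rU P.mult_closed by metis
  qed
  ultimately have w_supp: "w \<in> support_in ({0..int m} \<times> {0})"
    by (rule support_in_mono[OF support_in_Int]) auto
  have "xpow (- int m) * U \<in> support_in nonpos_axis"
  proof -
    have "xpow (- int m) * D \<in> support_in nonpos_axis"
      by (rule xpow_mult_support[OF D_m]) auto
    moreover have "xpow (- int m) * U = (xpow (- int m) * D) * recip Dm"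
      using recip[of Dm] d by (simp add: D mult.assoc)
    ultimately show ?thesis using rDm N.mult_closed by metis
  qed
  then have "xpow (int m) * (xpow (- int m) * U) \<in> support_in ({..int m} \<times> {0})"
    by (rule xpow_mult_support) auto
  then have "U \<in> support_in ({..int m} \<times> {0})"
    by (simp add: mult.assoc[symmetric] xpow_inverse)
  then have U_supp: "U \<in> support_in ({0..int m} \<times> {0})"
    by (rule support_in_mono[OF support_in_Int[OF U_P]]) auto
  define pU where "pU = poly_of_series m U"
  define pw where "pw = poly_of_series m w"
  define Q where "Q = pU * pw"
  have poly_U: "poly pU (xpow 1) = U" and poly_w: "poly pw (xpow 1) = w"
    unfolding pU_def pw_def using U_supp w_supp by (auto intro!: poly_of_series)
  have poly_Q: "poly Q (xpow 1) = xpow (int m) * D"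
    by (simp add: Q_def poly_U poly_w w_def D mult_ac)
  \<comment> \<open>The coefficients of \<open>Q\<close> are read off from \<open>x^m D\<close>,
    which is polynomial in \<open>t\<close>; the coefficients of \<open>pU\<close> and
    \<open>pw\<close> are merely series in \<open>t\<close>.\<close>
  have "Polynomial.coeff Q i \<in> support_in {0}" for i
    unfolding Q_def pU_def pw_def
    by (intro Z.coeff_mult_closed) (auto simp: coeff_poly_of_series xcoeff_support Z.zero_closed)
  then have "Polynomial.coeff Q i = xcoeff (int i) (xpow (int m) * D)" for i
    by (subst coeff_eq_xcoeff_poly) (simp_all add: poly_Q)
  moreover have "xpow (int m) * D \<in> range fps_of_poly"
    unfolding xpow_def using assms(2) fps_const_in_range_fps_of_poly by (intro R.mult_closed)
  ultimately have Q_coeff: "Polynomial.coeff Q i \<in> t_polys {0}" for i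
    by (simp add: xcoeff_t_polys)
  have "fps_nth D 0 = 1" using d by simp
  then have "D \<noteq> 0" by auto
  moreover have "xpow (int m) \<noteq> 0" using xpow_inverse[of "int m"] by auto
  ultimately have "poly Q (xpow 1) \<noteq> 0" unfolding poly_Q by simp
  then have "Q \<noteq> 0" by auto
  \<comment> \<open>The coefficient of \<open>x^m\<close> in \<open>w\<close> is the constant term
    of \<open>Dm\<close>. Hence \<open>pw\<close> is monic and \<open>pU\<close> has the leading
    coefficient of \<open>Q\<close>, which settles the leading coefficients of both factors.\<close>
  have pw_m: "Polynomial.coeff pw m = 1"
    using d by (simp add: pw_def coeff_poly_of_series w_def xcoeff_xpow xcoeff_0)
  moreover have "Polynomial.degree pw \<le> m"
    by (rule degree_le) (auto simp: pw_def coeff_poly_of_series)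
  ultimately have "Polynomial.degree pw = m"
    by (metis le_antisym le_degree zero_neq_one)
  with pw_m have lead_w: "Polynomial.lead_coeff pw = 1" by simp
  then have lead_U: "Polynomial.lead_coeff pU \<in> t_polys {0}"
    using Q_coeff[of "Polynomial.degree Q"] by (simp add: Q_def lead_coeff_mult)
  have alg_U: "algebraic_over (t_polys {0}) (Polynomial.coeff pU i)" for i
    by (rule algebraic_over_coeff_factor[OF A0.subdomain_of_axioms Q_def \<open>Q \<noteq> 0\<close> Q_coeff])
      (rule A0.algebraic_over_base[OF lead_U])
  have alg_w: "algebraic_over (t_polys {0}) (Polynomial.coeff pw i)" for i
    by (rule algebraic_over_coeff_factor[OF A0.subdomain_of_axioms _ \<open>Q \<noteq> 0\<close> Q_coeff, of _ pU])
      (simp_all add: Q_def mult.commute lead_w A0.algebraic_over_base A0.one_closed)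
  \<comment> \<open>Putting \<open>x = 0\<close> in \<open>D0 Dp\<close> leaves \<open>D0\<close>,
    which is thus a coefficient of \<open>pU\<close>.\<close>
  have "Polynomial.coeff pU 0 = D0 * proj {0} Dp"
    using d by (simp add: pU_def coeff_poly_of_series xcoeff_0 U_def proj_mult_nonneg support_in_constants proj_id)
  then have pU0: "Polynomial.coeff pU 0 = D0" using d by simp
  then show alg_D0: "algebraic_over (t_polys {0}) D0" using alg_U[of 0] by simp
  have up: "algebraic_over (t_polys nonneg_axis) F" if "algebraic_over (t_polys {0}) F" for F
    using that by (rule algebraic_over_mono) (rule t_polys_mono, simp add: zero_prod_def)
  have xpow_A1: "algebraic_over (t_polys nonneg_axis) (xpow (int k))" for k
    by (rule A1.algebraic_over_base)
      (auto simp: xpow_def t_polys_def support_in_const keys_mon fps_const_in_range_fps_of_poly)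
  have eval: "algebraic_over (t_polys nonneg_axis) (poly p (xpow 1))"
    if "\<And>i. algebraic_over (t_polys {0}) (Polynomial.coeff p i)" for p
  proof -
    have "poly p (xpow 1) \<in> {b. algebraic_over (t_polys nonneg_axis) b}"
      unfolding poly_altdef using up[OF that] xpow_A1[of 1]
      by (intro alg1.sum_closed alg1.mult_closed alg1.power_closed) auto
    then show ?thesis by simp
  qed
  have D0_recip: "recip D0 * D0 = 1" using d recip[of D0] by (simp add: mult.commute)
  then have "algebraic_over (t_polys nonneg_axis) (recip D0)"
    by (rule A1.algebraic_over_inverse[OF up[OF alg_D0]])
  moreover have "algebraic_over (t_polys nonneg_axis) U" using eval[of pU] alg_U poly_U by simp
  moreover have "Dp = U * recip D0"
  proof -
    have "U * recip D0 = Dp * (recip D0 * D0)" by (simp only: U_def mult_ac)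
    then show ?thesis by (simp add: D0_recip)
  qed
  ultimately show "algebraic_over (t_polys nonneg_axis) Dp"
    using A1.algebraic_over_add_mult(2) by metis
  have "algebraic_over (t_polys nonneg_axis) w" using eval[of pw] alg_w poly_w by simp
  \<comment> \<open>Negative powers of \<open>x\<close> are not in the coefficient ring, but they
    are algebraic over it as inverses.\<close>
  moreover have "algebraic_over (t_polys nonneg_axis) (xpow (- int m))"
    using xpow_inverse[of "- int m"] by (intro A1.algebraic_over_inverse[OF xpow_A1[of m]]) simp
  moreover have "Dm = w * xpow (- int m)"
  proof -
    have "w * xpow (- int m) = (xpow (int m) * xpow (- int m)) * Dm" by (simp only: w_def mult_ac)
    then show ?thesis by (simp add: xpow_inverse)
  qed
  ultimately show "algebraic_over (t_polys nonneg_axis) Dm"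
    using A1.algebraic_over_add_mult(2) by metis
qed

theorem theorem7p1:
  fixes S :: "(int \<times> int) set"
  assumes "finite S"
    and "\<forall>(i, j) \<in> S. \<bar>j\<bar> \<le> 1"
  shows "walk_gf {w \<in> walks S. bilateral w} = recip (sqrt_fps (Delta S)) \<and>
    (case canonical_factorization (Delta S) of (D0, Dp, Dm) \<Rightarrow>
       walk_gf {w \<in> walks S. on_slit_plane w} = sqrt_fps (D0 * Dm) * recip (walk_kernel S) \<and>
       walk_gf {w \<in> walks S. on_slit_plane w \<and> bilateral w} = recip (sqrt_fps Dp) \<and>
       walk_gf {w \<in> walks S. is_loop w} = recip (sqrt_fps D0)) \<and>
    algebraic_series poly_x (walk_gf {w \<in> walks S. bilateral w}) \<and>
    algebraic_series poly_xy (walk_gf {w \<in> walks S. on_slit_plane w}) \<and>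
    algebraic_series poly_x (walk_gf {w \<in> walks S. on_slit_plane w \<and> bilateral w}) \<and>
    algebraic_series const_ring (walk_gf {w \<in> walks S. is_loop w})"
proof -
  define B where "B = walk_gf {w \<in> walks S. bilateral w}"
  define W where "W = walk_gf {w \<in> walks S. on_slit_plane w}"
  define S0 where "S0 = walk_gf {w \<in> walks S. on_slit_plane w \<and> bilateral w}"
  define L where "L = walk_gf {w \<in> walks S. is_loop w}"
  define K where "K = walk_kernel S"
  obtain G h where B2: "B ^ 2 * Delta S = 1" and B0: "fps_nth B 0 = 1" and W: "W = G * recip K"
    and G0: "fps_nth G 0 = 1" and S00: "fps_nth S0 0 = 1" and h0: "fps_nth h 0 = 1" and hL: "h * L = 1"
    and canonical: "is_canonical_factorization (Delta S) (h ^ 2) (recip S0 ^ 2) ((G * L) ^ 2)"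
    using slit_plane_series[OF assms] unfolding B_def W_def S0_def L_def K_def by blast
  \<comment> \<open>The normalizing constant cancels in \<open>D0 Dm\<close>, so its square root is
    the numerator \<open>G\<close> of the slit plane series.\<close>
  have G2: "h ^ 2 * (G * L) ^ 2 = G ^ 2"
  proof -
    have "h ^ 2 * (G * L) ^ 2 = (h * L) ^ 2 * G ^ 2" by (simp only: power_mult_distrib mult_ac)
    then show ?thesis by (simp add: hL)
  qed
  have "(recip B) ^ 2 = (B ^ 2 * Delta S) * (recip B) ^ 2" by (simp add: B2)
  also have "\<dots> = (B * recip B) ^ 2 * Delta S" by (simp only: power_mult_distrib mult_ac)
  finally have "(recip B) ^ 2 = Delta S" by (simp add: recip[OF B0])
  then have "sqrt_fps (Delta S) = recip B" by (rule sqrt_fps_unique) simp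
  then have 1: "B = recip (sqrt_fps (Delta S))" by (simp add: recip_recip[OF B0])
  have 2: "W = sqrt_fps (h ^ 2 * (G * L) ^ 2) * recip K"
    unfolding G2 W using sqrt_fps_unique[OF refl G0] by simp
  have "sqrt_fps (recip S0 ^ 2) = recip S0" by (rule sqrt_fps_unique[OF refl]) simp
  then have 3: "S0 = recip (sqrt_fps (recip S0 ^ 2))" by (simp add: recip_recip[OF S00])
  have 4: "L = recip (sqrt_fps (h ^ 2))"
    using sqrt_fps_unique[OF refl h0] recip_unique[OF h0 hL] by simp

  interpret R: subdomain_of "range (fps_of_poly :: laurent poly \<Rightarrow> _)"
    by (rule subdomain_of_range_fps_of_poly)
  interpret A0: subdomain_of "t_polys {0}" by (rule subdomain_of_t_polys) auto
  interpret A1: subdomain_of "t_polys nonneg_axis"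
    by (rule subdomain_of_t_polys) (auto simp: zero_prod_def)
  interpret A2: subdomain_of "t_polys ({0..} \<times> {0..})"
    by (rule subdomain_of_t_polys) (auto simp: zero_prod_def)
  have X_range: "fps_X \<in> range (fps_of_poly :: laurent poly \<Rightarrow> _)"
    by (metis fps_of_poly_fps_X rangeI)
  have "(4 :: laurent fps) \<in> range fps_of_poly" by (metis fps_of_poly_numeral rangeI)
  then have "Delta S \<in> range fps_of_poly"
    unfolding Delta_def using X_range fps_const_in_range_fps_of_poly
    by (intro R.diff_closed R.mult_closed R.power_closed R.one_closed)
  note factors = canonical_factors_algebraic[OF canonical this]
  have h2_alg: "algebraic_over (t_polys nonneg_axis) (h ^ 2)"
    using factors(1) by (rule algebraic_over_mono) (rule t_polys_mono, simp add: zero_prod_def)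
  have G2_alg: "algebraic_over (t_polys nonneg_axis) (G ^ 2)"
    using A1.algebraic_over_add_mult(2)[OF h2_alg factors(3)] by (simp add: G2)
  have "algebraic_over (t_polys nonneg_axis) (Delta S)"
  proof -
    have "Delta S = h ^ 2 * recip S0 ^ 2 * (G * L) ^ 2"
      using canonical by (simp add: is_canonical_factorization_def)
    then show ?thesis
      using A1.algebraic_over_add_mult(2)[OF A1.algebraic_over_add_mult(2)[OF h2_alg factors(2)] factors(3)]
      by simp
  qed
  then have B_alg: "algebraic_over (t_polys nonneg_axis) B"
    using B2 by (blast intro: A1.algebraic_over_sqrt A1.algebraic_over_inverse)
  have "S0 ^ 2 * recip S0 ^ 2 = 1" by (simp add: power_mult_distrib[symmetric] recip[OF S00])
  then have S0_alg: "algebraic_over (t_polys nonneg_axis) S0"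
    using factors(2) by (blast intro: A1.algebraic_over_sqrt A1.algebraic_over_inverse)
  have "algebraic_over (t_polys {0}) h" using factors(1) by (rule A0.algebraic_over_sqrt)
  then have L_alg: "algebraic_over (t_polys {0}) L"
    by (rule A0.algebraic_over_inverse) (use hL in \<open>simp add: mult.commute\<close>)
  have "algebraic_over (t_polys nonneg_axis) G" using G2_alg by (rule A1.algebraic_over_sqrt)
  then have G_alg: "algebraic_over (t_polys ({0..} \<times> {0..})) G"
    by (rule algebraic_over_mono) (rule t_polys_mono, auto)
  have K_range: "K \<in> range fps_of_poly"
    unfolding K_def walk_kernel_def using X_range fps_const_in_range_fps_of_poly
    by (intro R.diff_closed R.mult_closed R.one_closed)
  then obtain m where m: "K \<in> support_in ({- int m..int m} \<times> {- int m..int m})"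
    using fps_of_poly_bounded_support by (metis imageE)
  \<comment> \<open>The kernel may have negative exponents in both variables; the monomial
    \<open>x^m y^m\<close> clears them.\<close>
  have "algebraic_over (t_polys ({0..} \<times> {0..})) K"
  proof (rule A2.algebraic_over_multiple)
    let ?a = "fps_const (Defs.mon (int m) (int m))"
    show "?a \<in> t_polys ({0..} \<times> {0..})"
      by (simp add: t_polys_def support_in_const keys_mon fps_const_in_range_fps_of_poly)
    show "?a \<noteq> 0" using keys_mon[of "int m" "int m"] by auto
    have "?a * K \<in> support_in ({0..} \<times> {0..})"
      by (rule support_in_mult[OF _ m, of _ "{(int m, int m)}"]) (auto simp: support_in_const keys_mon)
    moreover have "?a * K \<in> range fps_of_poly"
      using K_range fps_const_in_range_fps_of_poly by (intro R.mult_closed)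
    ultimately show "?a * K \<in> t_polys ({0..} \<times> {0..})" by (simp add: t_polys_def)
  qed
  moreover have "recip K * K = 1"
    using recip[of K] by (simp add: K_def walk_kernel_def mult.commute)
  ultimately have "algebraic_over (t_polys ({0..} \<times> {0..})) (recip K)"
    by (rule A2.algebraic_over_inverse)
  with G_alg have W_alg: "algebraic_over (t_polys ({0..} \<times> {0..})) W"
    unfolding W by (rule A2.algebraic_over_add_mult)
  have "algebraic_series poly_x B" "algebraic_series poly_xy W" "algebraic_series poly_x S0"
    "algebraic_series const_ring L"
    using B_alg W_alg S0_alg L_alg
    by (auto elim!: algebraic_series_if_algebraic_over simp: poly_x_def poly_xy_def const_ring_def zero_prod_def)
  with 1 2 3 4 show ?thesis
    unfolding canonical_factorization_eqI[OF canonical] B_def W_def S0_def L_def K_def by simp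
qed

end
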